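(* Let $B=\{B_t,t\ge0\}$ be an $m$-dimensional fractional Brownian motion with Hurst parameter $H>1/2$, let $X_0\in\mathbb{R}^d$ and $T>0$, and consider the stochastic differential equation $$X_t=X_0+\int_0^t\sigma(X_s)\,dB_s,$$ where $\sigma:\mathbb{R}^d\to\mathbb{R}^{md}$ is continuously differentiable. If $\sigma'$ is bounded and Hölder continuous of order $\lambda_0>\frac1H-1$, then $$E\Big(\sup_{0\le t\le T}|X_t|^p\Big)<\infty$$ for all $p\ge2$. If furthermore $\sigma$ is bounded, then for every $\beta\in(\tfrac12,H)$, $$E\Big(\exp\Big(\lambda\sup_{0\le t\le T}|X_t|^\gamma\Big)\Big)<\infty$$ for any $\lambda>0$ and $0<\gamma<2\beta$.
   Context: An $m$-dimensional fractional Brownian motion with Hurst parameter $H$ is a centered Gaussian process $B=(B^1,\dots,B^m)$ with $E(B^i_tB^j_s)=R_H(t,s)\delta_{ij}$, where $R_H(t,s)=\frac12\left(t^{2H}+s^{2H}-|t-s|^{2H}\right)$. The stochastic integral is a path-wise Riemann–Stieltjes integral; writing $\sigma=(\sigma^{ij})_{1\le i\le d,\,1\le j\le m}$, the equation reads componentwise $X^i_t=X^i_0+\sum_{j=1}^m\int_0^t\sigma^{ij}(X_s)\,dB^j_s$. Under the stated assumptions on $\sigma$ (continuously differentiable, $\sigma'$ bounded and Hölder continuous of order greater than $\frac1H-1$) it is known that the equation has a unique solution. *)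

theory Defs
  imports "HOL-Probability.Probability"
begin

(* Normal distribution N(mu, s^2) with s \<ge> 0: the variance may vanish, as it does for
   B 0 or for linear combinations of B at different times that are almost surely constant. *)
definition gaussian_rv :: "'w measure \<Rightarrow> ('w \<Rightarrow> real) \<Rightarrow> bool" where
  "gaussian_rv M Y \<longleftrightarrow> Y \<in> borel_measurable M \<and>
     ((\<exists>\<mu> s. s > 0 \<and> distributed M lborel Y (\<lambda>x. ennreal (normal_density \<mu> s x))) \<or>
      (\<exists>c. AE \<omega> in M. Y \<omega> = c))"

(* Joint Gaussianity of all finite-dimensional marginals: every finite linear combination
   of the components B^i_t (t \<ge> 0) is a real Gaussian variable. *)
definition gaussian_process :: "'w measure \<Rightarrow> (real \<Rightarrow> 'w \<Rightarrow> real ^ 'm) \<Rightarrow> bool" where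
  "gaussian_process M B \<longleftrightarrow>
     (\<forall>t\<ge>0. B t \<in> borel_measurable M) \<and>
     (\<forall>F c. finite F \<longrightarrow> F \<subseteq> {0..} \<longrightarrow>
        gaussian_rv M (\<lambda>\<omega>. \<Sum>t\<in>F. \<Sum>i\<in>UNIV. c t i * B t \<omega> $ i))"

definition fbm_cov :: "real \<Rightarrow> real \<Rightarrow> real \<Rightarrow> real" where
  "fbm_cov H t s = (t powr (2 * H) + s powr (2 * H) - \<bar>t - s\<bar> powr (2 * H)) / 2"

definition fractional_brownian_motion ::
    "'w measure \<Rightarrow> real \<Rightarrow> (real \<Rightarrow> 'w \<Rightarrow> real ^ 'm) \<Rightarrow> bool" where
  "fractional_brownian_motion M H B \<longleftrightarrow>
     0 < H \<and> H < 1 \<and> gaussian_process M B \<and>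
     (\<forall>t\<ge>0. \<forall>i. (LINT \<omega>|M. B t \<omega> $ i) = 0) \<and>
     (\<forall>t\<ge>0. \<forall>s\<ge>0. \<forall>i j. (LINT \<omega>|M. B t \<omega> $ i * B s \<omega> $ j) =
        (if i = j then fbm_cov H t s else 0))"

definition holder_continuous :: "real \<Rightarrow> ('a::metric_space \<Rightarrow> 'b::metric_space) \<Rightarrow> bool" where
  "holder_continuous \<alpha> f \<longleftrightarrow> (\<exists>C. \<forall>x y. dist (f x) (f y) \<le> C * dist x y powr \<alpha>)"

(* Riemann-Stieltjes integral of f with respect to g over [a,b], as the limit of the tagged
   sums when the mesh tends to 0. An element (x, k) of p is an interval k = [Inf k, Sup k]
   with its tag x. *)
definition has_RS_integral ::
    "(real \<Rightarrow> real) \<Rightarrow> (real \<Rightarrow> real) \<Rightarrow> real \<Rightarrow> real \<Rightarrow> real \<Rightarrow> bool" where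
  "has_RS_integral f g I a b \<longleftrightarrow>
     (\<forall>\<epsilon>>0. \<exists>\<delta>>0. \<forall>p. p tagged_division_of {a..b} \<longrightarrow> (\<forall>(x, k)\<in>p. Sup k - Inf k < \<delta>) \<longrightarrow>
        \<bar>(\<Sum>(x, k)\<in>p. f x * (g (Sup k) - g (Inf k))) - I\<bar> < \<epsilon>)"

(* The i-th component of X_t = x0 + int_0^t sigma(X_s) dB_s on [0,T], path by path; I i j is
   the integral of sigma^{ij}(X_s) with respect to B^j, whose existence is part of the
   requirement. No Hoelder regularity of the paths of X is imposed. *)
definition pathwise_sde_solution ::
    "'w measure \<Rightarrow> real \<Rightarrow> (real ^ 'd \<Rightarrow> real ^ 'm ^ 'd) \<Rightarrow> real ^ 'd \<Rightarrow>
     (real \<Rightarrow> 'w \<Rightarrow> real ^ 'm) \<Rightarrow> (real \<Rightarrow> 'w \<Rightarrow> real ^ 'd) \<Rightarrow> bool" where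
  "pathwise_sde_solution M T \<sigma> x0 B X \<longleftrightarrow>
     (\<forall>t\<in>{0..T}. X t \<in> borel_measurable M) \<and>
     (AE \<omega> in M. continuous_on {0..T} (\<lambda>t. X t \<omega>) \<and>
        (\<forall>t\<in>{0..T}. \<exists>I.
           (\<forall>i j. has_RS_integral (\<lambda>s. \<sigma> (X s \<omega>) $ i $ j) (\<lambda>s. B s \<omega> $ j) (I i j) 0 t) \<and>
           (\<forall>i. X t \<omega> $ i = x0 $ i + (\<Sum>j\<in>UNIV. I i j))))"

(* E Y < infinity for a nonnegative Y that is determined only up to a null set. The completion
   is needed because a supremum over uncountably many t of processes with almost surely
   continuous paths is in general measurable only modulo null sets. *)
definition finite_expectation :: "'w measure \<Rightarrow> ('w \<Rightarrow> real) \<Rightarrow> bool" where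
  "finite_expectation M Y \<longleftrightarrow> integrable (completion M) Y"

end

(* The existence of the Riemann-Stieltjes integrals forces a Saks-Henstock property: along the
   dyadic partitions of [0,T] a solution satisfies the Euler scheme up to errors that are summable
   with total mass tending to 0. If every increment of B over a dyadic interval of length h is at
   most K h^beta with beta > 1/2, then a dyadic recursion (comparing a one-step Euler increment
   over an interval with the two over its halves, as in the discrete sewing lemma) propagates these
   vanishing errors and yields |X_t - X_s| <= c S K (t-s)^beta on dyadic intervals with
   L K (t-s)^beta small, where S bounds sigma(X) there and L is a Lipschitz constant of sigma.
   Covering [0,T] by O(1 + K^(1/beta)) such intervals bounds sup|X| by a constant times
   exp(C K^(1/beta)), and by C (1 + K^(1/beta)) if sigma is bounded. Finally
   E exp(a K^2) < infinity for some a > 0, by summing Gaussian moments of the dyadic increments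
   of B, which is enough since 1/beta < 2 and gamma/beta < 2. *)
theory Submission imports Defs begin

section \<open>Riemann--Stieltjes sums along dyadic partitions\<close>

text \<open>The paths of X are known only to be continuous: there is no finite Hoelder norm of X to
  absorb in a Young-type estimate, and a single Euler remainder has no known rate as the cells
  shrink. Only the sum of the remainders over a whole level is known to vanish. This suffices
  because the comparison of a level with the next is linear in the remainders: a halving amplifies
  them by at most \<open>1 + L * q n\<close>, the product of these factors over all finer levels
  stays bounded since \<open>q n\<close> decays geometrically, and in the limit only the quadratic
  terms \<open>L * S * (q n)\<^sup>2\<close> survive. They are summable because a halving doubles
  their number but multiplies each by \<rho> squared, with \<open>2 * \<rho>\<^sup>2 < 1\<close>. A
  second obstacle is that S depends on the unknown path. On a compact interval it is a finite
  maximum, and if the interval is short enough, half of it moves to the other side of the estimate,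
  leaving only the left endpoint. Hence |X| + |\<sigma>(0)| at most doubles on each interval, which
  turns the number of intervals into an exponent.\<close>

definition rs_sum :: "(real \<Rightarrow> real) \<Rightarrow> (real \<Rightarrow> real) \<Rightarrow> (real \<times> real set) set \<Rightarrow> real" where
  "rs_sum f g p = (\<Sum>(x, k)\<in>p. f x * (g (Sup k) - g (Inf k)))"

definition mesh_below :: "real \<Rightarrow> (real \<times> real set) set \<Rightarrow> bool" where
  "mesh_below \<delta> p \<longleftrightarrow> (\<forall>(x, k)\<in>p. Sup k - Inf k < \<delta>)"

lemma has_RS_integral_alt:
  "has_RS_integral f g I a b \<longleftrightarrow> (\<forall>\<epsilon>>0. \<exists>\<delta>>0. \<forall>p. p tagged_division_of {a..b} \<longrightarrow>
     mesh_below \<delta> p \<longrightarrow> \<bar>rs_sum f g p - I\<bar> < \<epsilon>)"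
  unfolding has_RS_integral_def rs_sum_def mesh_below_def ..

lemma mesh_below_Un [simp]: "mesh_below \<delta> (p \<union> q) \<longleftrightarrow> mesh_below \<delta> p \<and> mesh_below \<delta> q"
  unfolding mesh_below_def by auto

lemma mesh_below_mono: "mesh_below \<delta> p \<Longrightarrow> \<delta> \<le> \<delta>' \<Longrightarrow> mesh_below \<delta>' p"
  unfolding mesh_below_def by force

lemma tagged_division_Un_real:
  assumes "p tagged_division_of {a..b}" "q tagged_division_of {b..c}" "a \<le> b" "b \<le> (c::real)"
  shows "(p \<union> q) tagged_division_of {a..c}"
proof -
  have "(p \<union> q) tagged_division_of ({a..b} \<union> {b..c})"
    using assms by (intro tagged_division_Un) auto
  moreover have "{a..b} \<union> {b..c} = {a..c}" using assms by auto
  ultimately show ?thesis by simp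
qed

text \<open>A tagged cell common to both divisions lies in the single point b, so its increment of g
  is zero and counting it once instead of twice changes nothing.\<close>

lemma rs_sum_Un:
  assumes p: "p tagged_division_of {a..b}" and q: "q tagged_division_of {b..(c::real)}"
  shows "rs_sum f g (p \<union> q) = rs_sum f g p + rs_sum f g q"
  unfolding rs_sum_def
proof (rule sum.union_inter_neutral)
  show "finite p" "finite q" using p q by auto
  show "\<forall>z\<in>p \<inter> q. (case z of (x, k) \<Rightarrow> f x * (g (Sup k) - g (Inf k))) = 0"
  proof clarify
    fix x k assume "(x, k) \<in> p" "(x, k) \<in> q"
    then have "x \<in> k" "k \<subseteq> {a..b}" "k \<subseteq> {b..c}"
      using tagged_division_ofD(2,3)[OF p] tagged_division_ofD(2,3)[OF q] by auto
    then have "k = {b}" by fastforce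
    then show "f x * (g (Sup k) - g (Inf k)) = 0" by simp
  qed
qed

lemma tagged_division_singleton_interval:
  assumes "a \<le> (b::real)"
  shows "{(a, {a..b})} tagged_division_of {a..b}" "rs_sum f g {(a, {a..b})} = f a * (g b - g a)"
    "mesh_below \<delta> {(a, {a..b})} \<longleftrightarrow> b - a < \<delta>"
proof -
  show "{(a, {a..b})} tagged_division_of {a..b}"
    by (rule tagged_division_of_self_real) (use assms in auto)
  show "rs_sum f g {(a, {a..b})} = f a * (g b - g a)" using assms by (simp add: rs_sum_def)
  show "mesh_below \<delta> {(a, {a..b})} \<longleftrightarrow> b - a < \<delta>" using assms by (simp add: mesh_below_def)
qed

lemma mesh_division_exists:
  assumes "\<delta> > 0"
  obtains p where "p tagged_division_of {a..b::real}" "mesh_below \<delta> p"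
proof -
  have "gauge (\<lambda>x::real. ball x (\<delta>/2))" using assms by (simp add: gauge_def)
  then obtain p where p: "p tagged_division_of {a..b}" "(\<lambda>x. ball x (\<delta>/2)) fine p"
    by (rule fine_division_exists_real)
  have "Sup k - Inf k < \<delta>" if xk: "(x, k) \<in> p" for x k
  proof -
    obtain u v where uv: "k = cbox u v" using tagged_division_ofD(4)[OF p(1) xk] by blast
    moreover have "x \<in> k" using tagged_division_ofD(2)[OF p(1) that] .
    ultimately have "u \<in> k" "v \<in> k" "u \<le> v" by auto
    moreover have "k \<subseteq> ball x (\<delta>/2)" using p(2) that by (auto simp: fine_def)
    ultimately have "dist x u < \<delta>/2" "dist x v < \<delta>/2" by auto
    then have "v - u < \<delta>" unfolding dist_real_def by linarith
    with uv \<open>u \<le> v\<close> show ?thesis by simp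
  qed
  with p(1) show ?thesis by (intro that[of p]) (auto simp: mesh_below_def)
qed

lemma has_RS_integral_refl_eq:
  assumes "has_RS_integral f g I a a"
  shows "I = 0"
proof (rule ccontr)
  assume "I \<noteq> 0"
  then have "\<bar>I\<bar> > 0" by simp
  then obtain \<delta> where d: "\<delta> > 0"
    "\<And>p. p tagged_division_of {a..a} \<Longrightarrow> mesh_below \<delta> p \<Longrightarrow> \<bar>rs_sum f g p - I\<bar> < \<bar>I\<bar>"
    using assms unfolding has_RS_integral_alt by blast
  show False
    using d(2)[of "{(a, {a..a})}"] tagged_division_singleton_interval[OF order_refl[of a]] d(1) by simp
qed

text \<open>A solution supplies integrals over [0,t] only, while the Euler errors live on cells
  [s,t]. A fine division of [s,t] is completed by a fine division of [0,s] to one of [0,t], and the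
  two approximations are subtracted.\<close>

lemma has_RS_integral_diff:
  assumes s: "has_RS_integral f g I 0 s" and t: "has_RS_integral f g J 0 t" and "0 \<le> s" "s \<le> t"
  shows "has_RS_integral f g (J - I) s t"
  unfolding has_RS_integral_alt
proof (intro allI impI)
  fix \<epsilon> :: real assume "\<epsilon> > 0"
  then obtain \<delta>1 where d1: "\<delta>1 > 0"
    "\<And>p. p tagged_division_of {0..s} \<Longrightarrow> mesh_below \<delta>1 p \<Longrightarrow> \<bar>rs_sum f g p - I\<bar> < \<epsilon>/2"
    using s unfolding has_RS_integral_alt by (metis half_gt_zero)
  obtain \<delta>2 where d2: "\<delta>2 > 0"
    "\<And>p. p tagged_division_of {0..t} \<Longrightarrow> mesh_below \<delta>2 p \<Longrightarrow> \<bar>rs_sum f g p - J\<bar> < \<epsilon>/2"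
    using t \<open>\<epsilon> > 0\<close> unfolding has_RS_integral_alt by (metis half_gt_zero)
  have "\<bar>rs_sum f g p - (J - I)\<bar> < \<epsilon>"
    if p: "p tagged_division_of {s..t}" "mesh_below \<delta>2 p" for p
  proof -
    obtain q where q: "q tagged_division_of {0..s}" "mesh_below (min \<delta>1 \<delta>2) q"
      using mesh_division_exists[of "min \<delta>1 \<delta>2"] d1(1) d2(1) by auto
    have "\<bar>rs_sum f g q - I\<bar> < \<epsilon>/2" using q by (intro d1(2)) (auto elim: mesh_below_mono)
    moreover have "\<bar>rs_sum f g (q \<union> p) - J\<bar> < \<epsilon>/2"
      using q p assms(3,4) tagged_division_Un_real[OF q(1) p(1)]
      by (intro d2(2)) (auto elim: mesh_below_mono)
    ultimately show ?thesis using rs_sum_Un[OF q(1) p(1), of f g] by linarith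
  qed
  with d2(1) show "\<exists>\<delta>>0. \<forall>p. p tagged_division_of {s..t} \<longrightarrow> mesh_below \<delta> p \<longrightarrow>
      \<bar>rs_sum f g p - (J - I)\<bar> < \<epsilon>" by blast
qed

text \<open>Cells in \<open>P\<close> keep their single tag, the others are refined until their sum is \<open>\<eta>\<close>-close to
  the integral; this isolates the Saks--Henstock error of the cells in \<open>P\<close>.\<close>

lemma mixed_division_exists:
  fixes u I :: "_ \<Rightarrow> real"
  assumes I: "\<And>k. k < N \<Longrightarrow> has_RS_integral f g (I (u (Suc k)) - I (u k)) (u k) (u (Suc k))"
    and mono: "\<And>k. u k \<le> u (Suc k)" and mesh: "\<And>k. k \<in> P \<Longrightarrow> u (Suc k) - u k < \<delta>"
    and "\<delta> > 0" "\<eta> > 0"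
  shows "\<exists>p. p tagged_division_of {u 0..u N} \<and> mesh_below \<delta> p \<and>
    \<bar>rs_sum f g p - (\<Sum>k<N. if k \<in> P then f (u k) * (g (u (Suc k)) - g (u k))
      else I (u (Suc k)) - I (u k))\<bar> \<le> real N * \<eta>"
  using I
proof (induction N)
  case 0
  show ?case
    using tagged_division_singleton_interval[OF order_refl[of "u 0"]] \<open>\<delta> > 0\<close>
    by (intro exI[of _ "{(u 0, {u 0..u 0})}"] conjI) simp_all
next
  case (Suc N)
  let ?s = "\<lambda>k. if k \<in> P then f (u k) * (g (u (Suc k)) - g (u k)) else I (u (Suc k)) - I (u k)"
  obtain p where p: "p tagged_division_of {u 0..u N}" "mesh_below \<delta> p"
    "\<bar>rs_sum f g p - (\<Sum>k<N. ?s k)\<bar> \<le> real N * \<eta>"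
    using Suc.IH[OF Suc.prems] by fastforce
  obtain q where q: "q tagged_division_of {u N..u (Suc N)}" "mesh_below \<delta> q"
    "\<bar>rs_sum f g q - ?s N\<bar> \<le> \<eta>"
  proof (cases "N \<in> P")
    case True
    then show ?thesis
      using tagged_division_singleton_interval[OF mono[of N]] mesh[OF True] \<open>\<eta> > 0\<close>
      by (intro that[of "{(u N, {u N..u (Suc N)})}"]) simp_all
  next
    case False
    obtain \<delta>' where d: "\<delta>' > 0" "\<And>p. p tagged_division_of {u N..u (Suc N)} \<Longrightarrow> mesh_below \<delta>' p \<Longrightarrow>
        \<bar>rs_sum f g p - (I (u (Suc N)) - I (u N))\<bar> < \<eta>"
      using Suc.prems[of N] \<open>\<eta> > 0\<close> unfolding has_RS_integral_alt by blast
    obtain q where "q tagged_division_of {u N..u (Suc N)}" "mesh_below (min \<delta> \<delta>') q"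
      using mesh_division_exists[of "min \<delta> \<delta>'"] d(1) \<open>\<delta> > 0\<close> by auto
    moreover from this have "mesh_below \<delta> q" "mesh_below \<delta>' q" by (auto elim: mesh_below_mono)
    ultimately show ?thesis using False d(2)[of q] by (intro that[of q]) auto
  qed
  have "u 0 \<le> u N" using mono by (simp add: lift_Suc_mono_le)
  then have "(p \<union> q) tagged_division_of {u 0..u (Suc N)}"
    using tagged_division_Un_real[OF p(1) q(1)] mono by auto
  moreover have "\<bar>rs_sum f g (p \<union> q) - (\<Sum>k<Suc N. ?s k)\<bar> \<le> real (Suc N) * \<eta>"
  proof -
    have "rs_sum f g (p \<union> q) - (\<Sum>k<Suc N. ?s k) =
        (rs_sum f g p - (\<Sum>k<N. ?s k)) + (rs_sum f g q - ?s N)"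
      using rs_sum_Un[OF p(1) q(1)] by simp
    then show ?thesis using p(3) q(3) by (simp add: algebra_simps abs_le_iff)
  qed
  ultimately show ?case using p(2) q(2) by auto
qed

section \<open>The dyadic grid and the total Euler error of a level\<close>

definition dyad :: "real \<Rightarrow> nat \<Rightarrow> nat \<Rightarrow> real" where
  "dyad T n k = T * real k / 2 ^ n"

lemma dyad_0 [simp]: "dyad T n 0 = 0" "dyad T n (2 ^ n) = T"
  and dyad_Suc_level: "dyad T (Suc n) (2 * k) = dyad T n k"
  and dyad_diff: "dyad T n (Suc k) - dyad T n k = T / 2 ^ n"
  by (auto simp: dyad_def field_simps)

lemma dyad_mono: "T \<ge> 0 \<Longrightarrow> k \<le> l \<Longrightarrow> dyad T n k \<le> dyad T n l"
  by (simp add: dyad_def divide_right_mono mult_left_mono)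

lemma dyad_in: "T \<ge> 0 \<Longrightarrow> k \<le> 2 ^ n \<Longrightarrow> dyad T n k \<in> {0..T}"
  using dyad_mono[of T 0 k n] dyad_mono[of T k "2^n" n] by auto

text \<open>The definition of the integral controls only signed sums over all cells. Replacing the
  cells outside an arbitrary set P by nearly exact values isolates the signed error of P; taking for
  P the cells of positive and then those of negative error yields the sum of absolute
  values.\<close>

lemma RS_dyadic_errors_tendsto_0:
  assumes I: "\<And>t. t \<in> {0..T} \<Longrightarrow> has_RS_integral f g (I t) 0 t" and "T > 0"
  shows "(\<lambda>n. \<Sum>k<2^n. \<bar>f (dyad T n k) * (g (dyad T n (Suc k)) - g (dyad T n k))
           - (I (dyad T n (Suc k)) - I (dyad T n k))\<bar>) \<longlonglongrightarrow> 0"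
proof (rule LIMSEQ_I)
  fix \<epsilon> :: real assume "\<epsilon> > 0"
  then obtain \<delta> where d: "\<delta> > 0"
    "\<And>p. p tagged_division_of {0..T} \<Longrightarrow> mesh_below \<delta> p \<Longrightarrow> \<bar>rs_sum f g p - I T\<bar> < \<epsilon>/4"
    using I[of T] \<open>T > 0\<close> unfolding has_RS_integral_alt
    by (metis atLeastAtMost_iff less_imp_le order_refl zero_less_divide_iff zero_less_numeral)
  have I0: "I 0 = 0" using I[of 0] \<open>T > 0\<close> by (intro has_RS_integral_refl_eq) auto
  obtain n0 where n0: "T / \<delta> < 2 ^ n0" using real_arch_pow[of 2 "T/\<delta>"] by auto
  have bnd: "(\<Sum>k<2^n. \<bar>f (dyad T n k) * (g (dyad T n (Suc k)) - g (dyad T n k))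
           - (I (dyad T n (Suc k)) - I (dyad T n k))\<bar>) \<le> \<epsilon>/2" if n: "n \<ge> n0" for n
  proof -
    define u where "u = dyad T n"
    define s where "s = (\<lambda>k. f (u k) * (g (u (Suc k)) - g (u k)) - (I (u (Suc k)) - I (u k)))"
    have "(2::real) ^ n0 \<le> 2 ^ n" using n by simp
    then have "T / \<delta> < 2 ^ n" using n0 by linarith
    then have mesh: "T / 2 ^ n < \<delta>" using d(1) by (simp add: field_simps)
    have Iu: "has_RS_integral f g (I (u (Suc k)) - I (u k)) (u k) (u (Suc k))" if "k < 2^n" for k
      using that \<open>T > 0\<close> dyad_in[of T k n] dyad_in[of T "Suc k" n] dyad_mono[of T k "Suc k" n]
      by (intro has_RS_integral_diff I) (auto simp: u_def)
    have part: "\<bar>\<Sum>k\<in>P. s k\<bar> \<le> \<epsilon>/4" if P: "P \<subseteq> {..<2^n}" for P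
    proof (rule field_le_epsilon)
      \<comment> \<open>The slack e pays for the cells outside P, which can be refined only to
        within \<open>\<eta>\<close> of their integrals; there are at most 2^n of them.\<close>
      fix e :: real assume "e > 0"
      define \<eta> where "\<eta> = e / 2 ^ n"
      have "\<eta> > 0" using \<open>e > 0\<close> by (simp add: \<eta>_def)
      have "\<exists>p. p tagged_division_of {u 0..u (2^n)} \<and> mesh_below \<delta> p \<and>
        \<bar>rs_sum f g p - (\<Sum>k<2^n. if k \<in> P then f (u k) * (g (u (Suc k)) - g (u k))
          else I (u (Suc k)) - I (u k))\<bar> \<le> real (2^n) * \<eta>"
        using Iu mesh d(1) \<open>\<eta> > 0\<close> \<open>T > 0\<close>
        by (intro mixed_division_exists) (auto simp: u_def dyad_diff intro!: dyad_mono)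
      then obtain p where p: "p tagged_division_of {0..T}" "mesh_below \<delta> p"
        "\<bar>rs_sum f g p - (\<Sum>k<2^n. if k \<in> P then f (u k) * (g (u (Suc k)) - g (u k))
          else I (u (Suc k)) - I (u k))\<bar> \<le> e"
        by (auto simp: u_def \<eta>_def)
      have "(\<Sum>k<2^n. if k \<in> P then f (u k) * (g (u (Suc k)) - g (u k))
          else I (u (Suc k)) - I (u k)) =
         (\<Sum>k<2^n. (I (u (Suc k)) - I (u k)) + (if k \<in> P then s k else 0))"
        by (intro sum.cong) (auto simp: s_def)
      also have "\<dots> = (I (u (2^n)) - I (u 0)) + (\<Sum>k<2^n. if k \<in> P then s k else 0)"
        using sum_lessThan_telescope[of "\<lambda>k. I (u k)" "2^n"] by (simp add: sum.distrib)
      also have "(\<Sum>k<2^n. if k \<in> P then s k else 0) = (\<Sum>k\<in>{..<2^n} \<inter> P. s k)"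
        by (simp add: sum.inter_restrict)
      also have "{..<2^n} \<inter> P = P" using P by auto
      finally have "(\<Sum>k<2^n. if k \<in> P then f (u k) * (g (u (Suc k)) - g (u k))
          else I (u (Suc k)) - I (u k)) = I T + (\<Sum>k\<in>P. s k)" by (simp add: u_def I0)
      with p(3) d(2)[OF p(1,2)] show "\<bar>\<Sum>k\<in>P. s k\<bar> \<le> \<epsilon>/4 + e" by linarith
    qed
    have "(\<Sum>k<2^n. \<bar>s k\<bar>) = (\<Sum>k<2^n. (if s k \<ge> 0 then s k else 0) - (if s k < 0 then s k else 0))"
      by (intro sum.cong) auto
    also have "\<dots> = (\<Sum>k<2^n. if s k \<ge> 0 then s k else 0) - (\<Sum>k<2^n. if s k < 0 then s k else 0)"
      by (rule sum_subtractf)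
    also have "\<dots> = (\<Sum>k\<in>{k\<in>{..<2^n}. s k \<ge> 0}. s k) - (\<Sum>k\<in>{k\<in>{..<2^n}. s k < 0}. s k)"
      by (subst (1 2) sum.inter_filter) auto
    also have "\<dots> \<le> \<epsilon>/4 + \<epsilon>/4"
      using part[of "{k\<in>{..<2^n}. s k \<ge> 0}"] part[of "{k\<in>{..<2^n}. s k < 0}"] by force
    finally show ?thesis by (simp add: s_def u_def)
  qed
  show "\<exists>no. \<forall>n\<ge>no. norm ((\<Sum>k<2^n. \<bar>f (dyad T n k) * (g (dyad T n (Suc k)) - g (dyad T n k))
           - (I (dyad T n (Suc k)) - I (dyad T n k))\<bar>) - 0) < \<epsilon>"
  proof (intro exI[of _ n0] allI impI)
    fix n assume "n \<ge> n0"
    have "norm ((\<Sum>k<2^n. \<bar>f (dyad T n k) * (g (dyad T n (Suc k)) - g (dyad T n k))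
           - (I (dyad T n (Suc k)) - I (dyad T n k))\<bar>) - 0) =
        (\<Sum>k<2^n. \<bar>f (dyad T n k) * (g (dyad T n (Suc k)) - g (dyad T n k))
           - (I (dyad T n (Suc k)) - I (dyad T n k))\<bar>)"
      unfolding diff_zero real_norm_def by (intro abs_of_nonneg sum_nonneg abs_ge_zero)
    also have "\<dots> \<le> \<epsilon>/2" using \<open>n \<ge> n0\<close> by (rule bnd)
    also have "\<dots> < \<epsilon>" using \<open>\<epsilon> > 0\<close> by simp
    finally show "norm ((\<Sum>k<2^n. \<bar>f (dyad T n k) * (g (dyad T n (Suc k)) - g (dyad T n k))
           - (I (dyad T n (Suc k)) - I (dyad T n k))\<bar>) - 0) < \<epsilon>" .
  qed
qed

text \<open>The norm of a matrix is here the Euclidean norm of all its entries (Frobenius), so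
  Cauchy-Schwarz is applied to each row.\<close>

lemma norm_matrix_vector_mult_le:
  fixes A :: "real ^ 'm ^ 'd"
  shows "norm (A *v v) \<le> norm A * norm v"
proof -
  have "norm (A *v v) \<le> L2_set (\<lambda>i. norm (A $ i) * norm v) UNIV"
    unfolding norm_vec_def[of "A *v v"]
    by (intro L2_set_mono) (auto simp: matrix_vector_mul_component Cauchy_Schwarz_ineq2)
  also have "\<dots> = norm A * norm v"
    by (simp add: L2_set_left_distrib norm_vec_def[of A])
  finally show ?thesis .
qed

text \<open>The point u is approached by the left endpoints \<open>v n\<close> of the level-n cells
  that contain it. Passing to the next level either keeps the endpoint or moves it by one finer
  cell, so the distances add up to a geometric series, and continuity of g gives the limit.\<close>

lemma dyadic_chaining:
  fixes g :: "real \<Rightarrow> 'a::metric_space"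
  assumes cont: "continuous_on {a..a + h} g" and "h > 0" and \<rho>: "0 < \<rho>" "\<rho> < 1"
    and incr: "\<And>n k. k < 2 ^ n \<Longrightarrow> dist (g (a + dyad h n (Suc k))) (g (a + dyad h n k)) \<le> D * \<rho> ^ n"
    and u: "u \<in> {a..a + h}"
  shows "dist (g u) (g a) \<le> D / (1 - \<rho>)"
proof -
  have D: "0 \<le> D" using incr[of 0 0] by (auto intro: order_trans[OF zero_le_dist])
  show ?thesis
  proof (cases "u = a + h")
    \<comment> \<open>The right endpoint would have the index 2^n, to which no cell of
      \<open>incr\<close> belongs; it is reached in one step by the increment of level 0.\<close>
    case True
    have "dist (g u) (g a) \<le> D" using incr[of 0 0] True by (simp add: dyad_def)
    also have "\<dots> \<le> D / (1 - \<rho>)" using D \<rho> by (simp add: field_simps)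
    finally show ?thesis .
  next
    case False
    define w where "w = (u - a) / h"
    have w: "0 \<le> w" "w < 1" using u False \<open>h > 0\<close> by (auto simp: w_def field_simps)
    define k where "k = (\<lambda>n. nat \<lfloor>w * 2 ^ n\<rfloor>)"
    define v where "v = (\<lambda>n. a + dyad h n (k n))"
    have k: "real (k n) \<le> w * 2 ^ n" "w * 2 ^ n < real (k n) + 1" for n
      using w by (auto simp: k_def)
    have k_less: "k n < 2 ^ n" for n
    proof -
      have "w * 2 ^ n < 1 * 2 ^ n" using w by (intro mult_strict_right_mono) auto
      then have "real (k n) < 2 ^ n" using k(1)[of n] by linarith
      then show ?thesis by simp
    qed
    have v_le: "v n \<le> u" "u - v n \<le> h * (1/2) ^ n" for n
    proof -
      have "h * real (k n) \<le> h * (w * 2 ^ n)" "h * (w * 2 ^ n) \<le> h * (real (k n) + 1)"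
        using k[of n] \<open>h > 0\<close> by (auto intro!: mult_left_mono)
      moreover have "h * (w * 2 ^ n) = (u - a) * 2 ^ n" using \<open>h > 0\<close> by (simp add: w_def)
      ultimately have "h * real (k n) / 2 ^ n \<le> u - a" "u - a \<le> h * (real (k n) + 1) / 2 ^ n"
        by (simp_all add: pos_divide_le_eq pos_le_divide_eq)
      then show "v n \<le> u" "u - v n \<le> h * (1/2) ^ n"
        by (simp_all add: v_def dyad_def ring_distribs add_divide_distrib power_one_over)
    qed
    have step: "dist (g (v (Suc n))) (g (v n)) \<le> D * \<rho> ^ Suc n" for n
    proof -
      have "real (k (Suc n)) < 2 * real (k n) + 2" "2 * real (k n) < real (k (Suc n)) + 1"
        using k[of n] k[of "Suc n"] by auto
      then have "k (Suc n) = 2 * k n \<or> k (Suc n) = Suc (2 * k n)" by linarith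
      then show ?thesis
      proof
        assume "k (Suc n) = 2 * k n"
        then show ?thesis using D \<rho> by (simp add: v_def dyad_Suc_level)
      next
        assume *: "k (Suc n) = Suc (2 * k n)"
        then show ?thesis using incr[of "2 * k n" "Suc n"] k_less[of "Suc n"]
          by (simp add: v_def dyad_Suc_level)
      qed
    qed
    have bound: "dist (g (v n)) (g a) \<le> D * (1 - \<rho> ^ Suc n) / (1 - \<rho>)" for n
    proof (induction n)
      case 0
      then show ?case using k_less[of 0] D \<rho> by (simp add: v_def)
    next
      case (Suc n)
      have "dist (g (v (Suc n))) (g a) \<le> D * \<rho> ^ Suc n + D * (1 - \<rho> ^ Suc n) / (1 - \<rho>)"
        using step[of n] Suc dist_triangle[of "g (v (Suc n))" "g a" "g (v n)"] by linarith
      also have "\<dots> = D * (1 - \<rho> ^ Suc (Suc n)) / (1 - \<rho>)" using \<rho> by (simp add: field_simps)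
      finally show ?case .
    qed
    have "(\<lambda>n. u - v n) \<longlonglongrightarrow> 0"
    proof (rule tendsto_sandwich[OF _ _ tendsto_const])
      show "(\<lambda>n. h * (1/2) ^ n) \<longlonglongrightarrow> 0" by (intro tendsto_mult_right_zero LIMSEQ_realpow_zero) auto
    qed (use v_le in auto)
    then have "v \<longlonglongrightarrow> u" using tendsto_diff[OF tendsto_const[of u], of "\<lambda>n. u - v n" 0] by simp
    moreover have "v n \<in> {a..a + h}" for n
      using v_le(1)[of n] u \<open>h > 0\<close> by (auto simp: v_def dyad_def)
    ultimately have "(\<lambda>n. g (v n)) \<longlonglongrightarrow> g u"
      using continuous_on_tendsto_compose[OF cont, of v] u by auto
    then have "(\<lambda>n. dist (g (v n)) (g a)) \<longlonglongrightarrow> dist (g u) (g a)" by (intro tendsto_intros)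
    moreover have "dist (g (v n)) (g a) \<le> D / (1 - \<rho>)" for n
    proof -
      have "D * (1 - \<rho> ^ Suc n) / (1 - \<rho>) \<le> D * 1 / (1 - \<rho>)"
        using D \<rho> by (intro divide_right_mono mult_left_mono) auto
      then show ?thesis using bound[of n] by simp
    qed
    ultimately show ?thesis by (intro LIMSEQ_le_const2) auto
  qed
qed

section \<open>The equation along dyadic intervals\<close>

text \<open>For a driver with increments at most \<open>K h\<^sup>\<beta>\<close> on dyadic intervals of length \<open>h\<close>, the
  parameters are \<open>\<rho> = 2\<^sup>-\<^sup>\<beta>\<close> and \<open>q\<^sub>0\<close> of order \<open>K T\<^sup>\<beta>\<close>; \<open>2 \<rho>\<^sup>2 < 1\<close> says \<open>\<beta> > 1/2\<close>.\<close>

locale dyadic_equation =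
  fixes X :: "real \<Rightarrow> real ^ 'd" and B :: "real \<Rightarrow> real ^ 'm"
    and \<sigma> :: "real ^ 'd \<Rightarrow> real ^ 'm ^ 'd" and T L q\<^sub>0 \<rho> :: real
  assumes T: "T > 0" and L: "L \<ge> 1" and q\<^sub>0: "q\<^sub>0 \<ge> 0"
    and \<rho>: "0 < \<rho>" "\<rho> \<le> 3/4" "2 * \<rho>\<^sup>2 < 1"
    and Lipschitz: "norm (\<sigma> x - \<sigma> y) \<le> L * norm (x - y)"
    and cont_X: "continuous_on {0..T} X"
    and B_incr: "k < 2 ^ n \<Longrightarrow> norm (B (dyad T n (Suc k)) - B (dyad T n k)) \<le> q\<^sub>0 * \<rho> ^ n"
    and errors_tendsto_0: "(\<lambda>n. \<Sum>k<2^n. norm (X (dyad T n (Suc k)) - X (dyad T n k)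
          - \<sigma> (X (dyad T n k)) *v (B (dyad T n (Suc k)) - B (dyad T n k)))) \<longlonglongrightarrow> 0"
begin

definition q :: "nat \<Rightarrow> real" where "q n = q\<^sub>0 * \<rho> ^ n"

text \<open>The remainder of one Euler step over the k-th dyadic interval of level n, the quantity
  that a sewing argument shows to be of second order.\<close>

definition J :: "nat \<Rightarrow> nat \<Rightarrow> real ^ 'd" where
  "J n k = X (dyad T n (Suc k)) - X (dyad T n k)
     - \<sigma> (X (dyad T n k)) *v (B (dyad T n (Suc k)) - B (dyad T n k))"

definition err :: "nat \<Rightarrow> nat \<Rightarrow> nat \<Rightarrow> real" where
  "err j n k = (\<Sum>i\<in>{k * 2 ^ j..<Suc k * 2 ^ j}. norm (J (n + j) i))"

text \<open>In the bracket, 1 stands for the Euler increment and the fraction for its remainder; the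
  factor 4 bounds the chaining constant \<open>1 / (1 - \<rho>)\<close> for
  \<open>\<rho> \<le> 3/4\<close>.\<close>

definition c :: real where "c = 4 * (1 + 1 / (4 * (1 - 2 * \<rho>\<^sup>2)))"

lemma q_nonneg: "q n \<ge> 0" and q_Suc: "q (Suc n) = \<rho> * q n"
  using q\<^sub>0 \<rho> by (auto simp: q_def)

lemma c_ge: "c \<ge> 4" using \<rho> by (simp add: c_def)

lemma q_antimono: "q (n + i) \<le> q n"
proof -
  have "\<rho> ^ i \<le> 1" using \<rho> by (intro power_le_one) auto
  then have "q\<^sub>0 * \<rho> ^ n * \<rho> ^ i \<le> q\<^sub>0 * \<rho> ^ n * 1" using q\<^sub>0 \<rho> by (intro mult_left_mono) auto
  then show ?thesis by (simp add: q_def power_add)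
qed

lemma err_nonneg: "err j n k \<ge> 0" unfolding err_def by (intro sum_nonneg) auto

lemma err_0: "err 0 n k = norm (J n k)" by (simp add: err_def)

lemma err_Suc: "err (Suc j) n k = err j (Suc n) (2 * k) + err j (Suc n) (Suc (2 * k))"
proof -
  have "{k * 2 ^ Suc j..<Suc k * 2 ^ Suc j} =
      {2 * k * 2 ^ j..<Suc (2 * k) * 2 ^ j} \<union> {Suc (2 * k) * 2 ^ j..<Suc (Suc (2 * k)) * 2 ^ j}"
    by (subst ivl_disj_un_two(3)) (auto simp: algebra_simps)
  then show ?thesis unfolding err_def by (simp only:) (subst sum.union_disjoint, auto)
qed

lemma err_tendsto_0:
  assumes "k < 2 ^ n"
  shows "(\<lambda>j. err j n k) \<longlonglongrightarrow> 0"
proof (rule tendsto_sandwich[OF _ _ tendsto_const])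
  have "(\<lambda>n. \<Sum>k<2^n. norm (J n k)) \<longlonglongrightarrow> 0" using errors_tendsto_0 by (simp add: J_def)
  from LIMSEQ_ignore_initial_segment[OF this, of n]
  show "(\<lambda>j. \<Sum>k<2^(n + j). norm (J (n + j) k)) \<longlonglongrightarrow> 0"
    by (simp only: add.commute)
  show "\<forall>\<^sub>F j in sequentially. err j n k \<le> (\<Sum>k<2^(n + j). norm (J (n + j) k))"
  proof (intro always_eventually allI)
    fix j
    have "Suc k * 2 ^ j \<le> 2 ^ n * 2 ^ j" using assms by (intro mult_right_mono) auto
    then have "{k * 2 ^ j..<Suc k * 2 ^ j} \<subseteq> {..<2 ^ (n + j)}" by (auto simp: power_add)
    then show "err j n k \<le> (\<Sum>k<2^(n + j). norm (J (n + j) k))"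
      unfolding err_def by (intro sum_mono2) auto
  qed
qed (use err_nonneg in auto)

text \<open>Two half steps differ from one full step by (\<sigma>(X_m) - \<sigma>(X_s)) applied to
  B_t - B_m, with m the midpoint. The Lipschitz bound reduces this to X_m - X_s, which is the Euler
  increment of the left half plus its remainder; hence only the left remainder gets the factor
  \<open>1 + L * q n\<close>.\<close>

lemma J_split:
  assumes "k < 2 ^ n" and S: "norm (\<sigma> (X (dyad T n k))) \<le> S"
  shows "norm (J n k) \<le> (1 + L * q n) * norm (J (Suc n) (2 * k)) + norm (J (Suc n) (Suc (2 * k)))
    + L * S * (q n)\<^sup>2"
proof -
  define s m t where "s = dyad T n k" and "m = dyad T (Suc n) (Suc (2 * k))"
    and "t = dyad T n (Suc k)"
  have eqs: "dyad T (Suc n) (2 * k) = s" "dyad T (Suc n) (Suc (Suc (2 * k))) = t"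
    using dyad_Suc_level[of T n k] dyad_Suc_level[of T n "Suc k"] by (auto simp: s_def t_def)
  have S0: "S \<ge> 0" using S by (rule order_trans[OF norm_ge_zero])
  have Bm: "norm (B m - B s) \<le> q n" and Bt: "norm (B t - B m) \<le> q n"
    using B_incr[of "2 * k" "Suc n"] B_incr[of "Suc (2 * k)" "Suc n"] assms(1) q_antimono[of n 1]
    by (auto simp: q_def eqs m_def)
  have J1: "J (Suc n) (2 * k) = X m - X s - \<sigma> (X s) *v (B m - B s)"
    and J2: "J (Suc n) (Suc (2 * k)) = X t - X m - \<sigma> (X m) *v (B t - B m)"
    and J0: "J n k = X t - X s - \<sigma> (X s) *v (B t - B s)"
    unfolding J_def eqs by (auto simp: m_def s_def t_def)
  have "J n k = J (Suc n) (2 * k) + J (Suc n) (Suc (2 * k)) + (\<sigma> (X m) - \<sigma> (X s)) *v (B t - B m)"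
    unfolding J0 J1 J2 by (simp add: matrix_vector_mult_diff_distrib matrix_vector_mult_diff_rdistrib)
  moreover have "norm ((\<sigma> (X m) - \<sigma> (X s)) *v (B t - B m)) \<le> L * (norm (J (Suc n) (2 * k)) + S * q n) * q n"
  proof -
    have "X m - X s = J (Suc n) (2 * k) + \<sigma> (X s) *v (B m - B s)" by (simp add: J1)
    then have "norm (X m - X s) \<le> norm (J (Suc n) (2 * k)) + norm (\<sigma> (X s) *v (B m - B s))"
      by (metis norm_triangle_ineq)
    also have "norm (\<sigma> (X s) *v (B m - B s)) \<le> norm (\<sigma> (X s)) * norm (B m - B s)"
      by (rule norm_matrix_vector_mult_le)
    also have "\<dots> \<le> S * q n" using S S0 Bm by (intro mult_mono) (auto simp: s_def)
    finally have "L * norm (X m - X s) \<le> L * (norm (J (Suc n) (2 * k)) + S * q n)"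
      using L by (intro mult_left_mono) auto
    with Lipschitz have "norm (\<sigma> (X m) - \<sigma> (X s)) \<le> L * (norm (J (Suc n) (2 * k)) + S * q n)"
      by (rule order_trans)
    then have "norm (\<sigma> (X m) - \<sigma> (X s)) * norm (B t - B m) \<le> L * (norm (J (Suc n) (2 * k)) + S * q n) * q n"
      using Bt L S0 q_nonneg by (intro mult_mono) auto
    then show ?thesis using norm_matrix_vector_mult_le order_trans by blast
  qed
  ultimately have "norm (J n k) \<le> norm (J (Suc n) (2 * k)) + norm (J (Suc n) (Suc (2 * k)))
      + L * (norm (J (Suc n) (2 * k)) + S * q n) * q n"
    by (metis (no_types, lifting) add_mono norm_triangle_le norm_triangle_ineq)
  then show ?thesis by (simp add: algebra_simps power2_eq_square)
qed

text \<open>The factor \<open>1 + 8 L q\<^sub>n\<close> absorbs the growth \<open>1 + L q\<^sub>n\<close> from each halving, because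
  \<open>q\<^sub>n\<close> decays geometrically.\<close>

lemma J_bound_err:
  assumes "k < 2 ^ n" and "\<And>u. u \<in> {dyad T n k..dyad T n (Suc k)} \<Longrightarrow> norm (\<sigma> (X u)) \<le> S"
    and "L * q n \<le> 1/8"
  shows "norm (J n k) \<le> (1 + 8 * (L * q n)) * (L * S / (1 - 2 * \<rho>\<^sup>2) * (q n)\<^sup>2 + err j n k)"
  using assms
proof (induction j arbitrary: n k)
  case 0
  have S0: "S \<ge> 0"
    using 0(2)[of "dyad T n k"] dyad_mono[of T k "Suc k" n] T by (auto intro: order_trans[OF norm_ge_zero])
  have "1 * norm (J n k) \<le> (1 + 8 * (L * q n)) * (L * S / (1 - 2 * \<rho>\<^sup>2) * (q n)\<^sup>2 + norm (J n k))"
    using S0 L \<rho> q_nonneg by (intro mult_mono) (auto intro!: mult_nonneg_nonneg divide_nonneg_nonneg)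
  then show ?case by (simp add: err_0)
next
  case (Suc j)
  define s m t where "s = dyad T n k" and "m = dyad T (Suc n) (Suc (2 * k))"
    and "t = dyad T n (Suc k)"
  have eqs: "dyad T (Suc n) (2 * k) = s" "dyad T (Suc n) (Suc (Suc (2 * k))) = t"
    using dyad_Suc_level[of T n k] dyad_Suc_level[of T n "Suc k"] by (auto simp: s_def t_def)
  have smt: "s \<le> m" "m \<le> t"
    using dyad_mono[of T "2 * k" "Suc (2 * k)" "Suc n"]
      dyad_mono[of T "Suc (2 * k)" "Suc (Suc (2 * k))" "Suc n"] T by (auto simp: eqs m_def)
  have S: "norm (\<sigma> (X u)) \<le> S" if "u \<in> {s..t}" for u using Suc.prems(2) that by (simp add: s_def t_def)
  have S0: "S \<ge> 0" using S[of s] smt by (auto intro: order_trans[OF norm_ge_zero])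
  \<comment> \<open>A is the fixed point of the recursion without errors: A q_n^2 = 2 A q_{n+1}^2 +
    L S q_n^2, where q_{n+1} = \<rho> q_n.\<close>
  define A where "A = L * S / (1 - 2 * \<rho>\<^sup>2)"
  have A0: "A \<ge> 0" using L S0 \<rho> by (simp add: A_def)
  define x where "x = L * q n"
  have x: "0 \<le> x" "x \<le> 1/8" using L q_nonneg Suc.prems by (auto simp: x_def)
  have x': "L * q (Suc n) = \<rho> * x" by (simp add: x_def q_Suc)
  have \<rho>x: "\<rho> * x \<le> 3/4 * x" "0 \<le> \<rho> * x"
    using mult_right_mono[OF \<rho>(2) x(1)] x(1) \<rho>(1) by auto
  then have "\<rho> * x \<le> 1/8" using x by linarith
  then have IH: "norm (J (Suc n) (2 * k)) \<le> (1 + 8 * (\<rho> * x)) * (A * (q (Suc n))\<^sup>2 + err j (Suc n) (2 * k))"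
    "norm (J (Suc n) (Suc (2 * k))) \<le> (1 + 8 * (\<rho> * x)) * (A * (q (Suc n))\<^sup>2 + err j (Suc n) (Suc (2 * k)))"
    using Suc.IH[of "2 * k" "Suc n"] Suc.IH[of "Suc (2 * k)" "Suc n"] S smt Suc.prems(1)
    unfolding x' by (auto simp: eqs m_def[symmetric] A_def)
  define a where "a = A * (q (Suc n))\<^sup>2"
  define e1 e2 where "e1 = err j (Suc n) (2 * k)" and "e2 = err j (Suc n) (Suc (2 * k))"
  have pos: "a \<ge> 0" "e1 \<ge> 0" "e2 \<ge> 0" using A0 err_nonneg by (auto simp: a_def e1_def e2_def)
  \<comment> \<open>The origin of the 8: at the next level \<open>\<rho> \<le> 3/4\<close> lowers it
    to 6, one halving raises it to 7, and \<open>x \<le> 1/8\<close> bounds 6 x^2 by 3/4 x, which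
    leaves room below 8.\<close>
  have "(1 + x) * (1 + 8 * (\<rho> * x)) \<le> (1 + x) * (1 + 6 * x)" using x \<rho>x by (intro mult_left_mono) auto
  also have "\<dots> = 1 + 7 * x + 6 * x * x" by (simp add: algebra_simps)
  also have "6 * x * x \<le> 6 * x * (1/8)" using x by (intro mult_left_mono) auto
  finally have fac: "(1 + x) * (1 + 8 * (\<rho> * x)) \<le> 1 + 8 * x" using x by linarith
  have "(1 + x) * norm (J (Suc n) (2 * k)) \<le> (1 + x) * ((1 + 8 * (\<rho> * x)) * (a + e1))"
    using IH(1) x unfolding a_def e1_def by (intro mult_left_mono) auto
  also have "\<dots> \<le> (1 + 8 * x) * (a + e1)"
    using mult_right_mono[OF fac, of "a + e1"] pos by (simp add: mult.assoc)
  finally have 1: "(1 + x) * norm (J (Suc n) (2 * k)) \<le> (1 + 8 * x) * (a + e1)" .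
  have "norm (J (Suc n) (Suc (2 * k))) \<le> (1 + 8 * (\<rho> * x)) * (a + e2)"
    using IH(2) unfolding a_def e2_def .
  also have "\<dots> \<le> (1 + 8 * x) * (a + e2)" using \<rho>x x pos by (intro mult_right_mono) auto
  finally have 2: "norm (J (Suc n) (Suc (2 * k))) \<le> (1 + 8 * x) * (a + e2)" .
  have LS: "L * S = A * (1 - 2 * \<rho>\<^sup>2)" using \<rho> by (simp add: A_def)
  have aq: "a = \<rho>\<^sup>2 * (A * (q n)\<^sup>2)" by (simp add: a_def q_Suc power_mult_distrib)
  have "L * S * (q n)\<^sup>2 = A * (q n)\<^sup>2 - 2 * a" unfolding LS aq by (simp add: algebra_simps)
  moreover have "1 * (L * S * (q n)\<^sup>2) \<le> (1 + 8 * x) * (L * S * (q n)\<^sup>2)"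
    using x L S0 by (intro mult_right_mono) auto
  ultimately have 3: "L * S * (q n)\<^sup>2 \<le> (1 + 8 * x) * (A * (q n)\<^sup>2 - 2 * a)" by simp
  have "norm (J n k) \<le> (1 + x) * norm (J (Suc n) (2 * k)) + norm (J (Suc n) (Suc (2 * k))) + L * S * (q n)\<^sup>2"
    using J_split[OF Suc.prems(1), of S] S[of s] smt unfolding x_def by (simp add: s_def)
  also have "\<dots> \<le> (1 + 8 * x) * (a + e1) + (1 + 8 * x) * (a + e2) + (1 + 8 * x) * (A * (q n)\<^sup>2 - 2 * a)"
    using 1 2 3 by linarith
  also have "\<dots> = (1 + 8 * x) * (A * (q n)\<^sup>2 + err (Suc j) n k)"
    by (simp add: err_Suc e1_def e2_def algebra_simps)
  finally show ?case by (simp add: x_def A_def)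
qed

text \<open>The bound on \<open>J n k\<close> holds for every depth j and its left side is
  independent of j, so letting j tend to infinity removes the errors. What remains is quadratic; one
  factor \<open>L * q n \<le> 1/8\<close> together with \<open>1 + 8 * (L * q n) \<le> 2\<close>
  makes it the linear term with coefficient 1/4.\<close>

lemma increment_bound:
  assumes k: "k < 2 ^ n" and S: "\<And>u. u \<in> {dyad T n k..dyad T n (Suc k)} \<Longrightarrow> norm (\<sigma> (X u)) \<le> S"
    and q: "L * q n \<le> 1/8"
  shows "norm (X (dyad T n (Suc k)) - X (dyad T n k)) \<le> c / 4 * S * q n"
proof -
  have Ss: "norm (\<sigma> (X (dyad T n k))) \<le> S" using S dyad_mono[of T k "Suc k" n] T by auto
  then have S0: "S \<ge> 0" by (rule order_trans[OF norm_ge_zero])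
  define r where "r = 1 - 2 * \<rho>\<^sup>2"
  have r: "r > 0" using \<rho> by (simp add: r_def)
  have "(\<lambda>j. (1 + 8 * (L * q n)) * (L * S / r * (q n)\<^sup>2 + err j n k)) \<longlonglongrightarrow>
      (1 + 8 * (L * q n)) * (L * S / r * (q n)\<^sup>2 + 0)"
    by (intro tendsto_intros err_tendsto_0 k)
  then have "norm (J n k) \<le> (1 + 8 * (L * q n)) * (L * S / r * (q n)\<^sup>2 + 0)"
    by (rule LIMSEQ_le_const) (use J_bound_err[OF assms] in \<open>auto simp: r_def\<close>)
  also have "\<dots> = (1 + 8 * (L * q n)) * (L * q n) * (S * q n / r)"
    by (simp add: power2_eq_square)
  also have "\<dots> \<le> 2 * (1/8) * (S * q n / r)"
    using q S0 q_nonneg r L by (intro mult_mono mult_right_mono mult_nonneg_nonneg) auto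
  finally have "norm (J n k) \<le> 1 / (4 * r) * S * q n" by simp
  moreover have "norm (\<sigma> (X (dyad T n k)) *v (B (dyad T n (Suc k)) - B (dyad T n k))) \<le> S * q n"
    using norm_matrix_vector_mult_le[of "\<sigma> (X (dyad T n k))"] Ss S0 B_incr[OF k]
    by (intro order_trans[OF norm_matrix_vector_mult_le] mult_mono) (auto simp: q_def)
  moreover have "X (dyad T n (Suc k)) - X (dyad T n k) =
      J n k + \<sigma> (X (dyad T n k)) *v (B (dyad T n (Suc k)) - B (dyad T n k))" by (simp add: J_def)
  ultimately have "norm (X (dyad T n (Suc k)) - X (dyad T n k)) \<le> 1 / (4 * r) * S * q n + S * q n"
    using norm_triangle_mono by metis
  also have "\<dots> = c / 4 * S * q n" by (simp add: c_def r_def[symmetric] algebra_simps)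
  finally show ?thesis .
qed

text \<open>Every dyadic subinterval of depth i inherits both the bound S and the smallness
  condition, so \<open>increment_bound\<close> applies to it and gives increments decaying like
  \<rho>^i, as chaining requires.\<close>

lemma oscillation_bound:
  assumes k: "k < 2 ^ n" and S: "\<And>u. u \<in> {dyad T n k..dyad T n (Suc k)} \<Longrightarrow> norm (\<sigma> (X u)) \<le> S"
    and q: "L * q n \<le> 1/8" and u: "u \<in> {dyad T n k..dyad T n (Suc k)}"
  shows "norm (X u - X (dyad T n k)) \<le> c * S * q n"
proof -
  have S0: "S \<ge> 0" using S[OF u] by (rule order_trans[OF norm_ge_zero])
  define a h where "a = dyad T n k" and "h = T / 2 ^ n"
  have ah: "a + h = dyad T n (Suc k)" using dyad_diff[of T n k] by (simp add: a_def h_def)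
  have sub: "a + dyad h i l = dyad T (n + i) (k * 2 ^ i + l)" for i l
    by (simp add: a_def h_def dyad_def power_add field_simps)
  have "dist (X u) (X a) \<le> (c / 4 * S * q n) / (1 - \<rho>)"
  proof (rule dyadic_chaining[where h = h])
    have "{a..a + h} \<subseteq> {0..T}"
      using dyad_in[of T k n] dyad_in[of T "Suc k" n] k T unfolding ah unfolding a_def by auto
    then show "continuous_on {a..a + h} X" by (rule continuous_on_subset[OF cont_X])
    fix i l :: nat assume l: "l < 2 ^ i"
    have idx: "k * 2 ^ i + l < 2 ^ (n + i)"
    proof -
      have "k * 2 ^ i + l < Suc k * 2 ^ i" using l by simp
      also have "\<dots> \<le> 2 ^ n * 2 ^ i" using k by (intro mult_right_mono) auto
      finally show ?thesis by (simp add: power_add)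
    qed
    have sub_int: "{dyad T (n + i) (k * 2 ^ i + l)..dyad T (n + i) (Suc (k * 2 ^ i + l))} \<subseteq> {a..a + h}"
      using dyad_mono[of h 0 l i] dyad_mono[of h "Suc l" "2 ^ i" i] l T sub[of i l] sub[of i "Suc l"]
      by (auto simp: h_def)
    have "L * q (n + i) \<le> L * q n" using q_antimono L by (intro mult_left_mono) auto
    then have "norm (X (dyad T (n + i) (Suc (k * 2 ^ i + l))) - X (dyad T (n + i) (k * 2 ^ i + l)))
        \<le> c / 4 * S * q (n + i)"
      using q idx sub_int unfolding ah by (intro increment_bound S) (auto simp: a_def)
    then show "dist (X (a + dyad h i (Suc l))) (X (a + dyad h i l)) \<le> c / 4 * S * q n * \<rho> ^ i"
      by (simp add: sub dist_norm q_def power_add mult_ac)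
  qed (use \<rho> T u ah in \<open>auto simp: h_def a_def\<close>)
  also have "\<dots> \<le> (c / 4 * S * q n) / (1/4)"
    using \<rho> S0 c_ge q_nonneg by (intro divide_left_mono) auto
  finally show ?thesis by (simp add: dist_norm a_def)
qed

text \<open>The intervals of level n are traversed from left to right, and only the value at a left
  endpoint is handed on. The sequence b is arithmetic for bounded coefficients and geometric
  otherwise.\<close>

lemma propagate_bound:
  fixes V :: "real \<Rightarrow> real"
  assumes "V 0 \<le> b 0"
    and "\<And>k u. k < 2 ^ n \<Longrightarrow> V (dyad T n k) \<le> b k \<Longrightarrow> u \<in> {dyad T n k..dyad T n (Suc k)} \<Longrightarrow> V u \<le> b (Suc k)"
    and mono: "\<And>k. b k \<le> b (Suc k)" and u: "u \<in> {0..T}"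
  shows "V u \<le> b (2 ^ n)"
proof -
  have step: "\<forall>u\<in>{0..dyad T n k}. V u \<le> b k" if "k \<le> 2 ^ n" for k
    using that
  proof (induction k)
    case 0
    then show ?case using assms(1) by simp
  next
    case (Suc k)
    have *: "dyad T n k \<in> {0..dyad T n k}" using T by (auto simp: dyad_def)
    show ?case
    proof
      fix u assume u: "u \<in> {0..dyad T n (Suc k)}"
      show "V u \<le> b (Suc k)"
      proof (cases "u \<le> dyad T n k")
        case True
        with Suc u have "V u \<le> b k" by auto
        then show ?thesis using mono[of k] by linarith
      next
        case False
        then show ?thesis using Suc * u by (intro assms(2)) auto
      qed
    qed
  qed
  from step[of "2 ^ n"] u show ?thesis by simp
qed

text \<open>The condition on q serves twice: as \<open>c \<ge> 4\<close> it implies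
  \<open>L * q n \<le> 1/8\<close>, and as \<open>L \<ge> 1\<close> it implies
  \<open>c * q n \<le> 1\<close>, so that each of the 2^n intervals adds at most S.\<close>

lemma bounded_coefficient_bound:
  assumes S: "\<And>x. norm (\<sigma> x) \<le> S" and q: "2 * c * (L * q n) \<le> 1" and u: "u \<in> {0..T}"
  shows "norm (X u) \<le> norm (X 0) + S * 2 ^ n"
proof -
  have S0: "S \<ge> 0" using S[of 0] by (rule order_trans[OF norm_ge_zero])
  have Lq: "0 \<le> L * q n" "q n \<le> L * q n" using L q_nonneg[of n] mult_right_mono[of 1 L "q n"] by auto
  have "8 * (L * q n) \<le> 2 * c * (L * q n)" using c_ge Lq by (intro mult_right_mono) auto
  then have q8: "L * q n \<le> 1/8" using q by linarith
  have "c * q n \<le> c * (L * q n)" using c_ge Lq by (intro mult_left_mono) auto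
  then have "S * (c * q n) \<le> S * 1" using q S0 by (intro mult_left_mono) auto
  then have cSq: "c * S * q n \<le> S" by (simp add: mult_ac)
  have "norm (X u) \<le> norm (X 0) + S * real (2 ^ n)"
  proof (rule propagate_bound[OF _ _ _ u])
    fix k u assume k: "k < 2 ^ n" "norm (X (dyad T n k)) \<le> norm (X 0) + S * real k"
      "u \<in> {dyad T n k..dyad T n (Suc k)}"
    have "norm (X u) \<le> norm (X (dyad T n k)) + norm (X u - X (dyad T n k))"
      using norm_triangle_sub by blast
    also have "norm (X u - X (dyad T n k)) \<le> c * S * q n"
      by (rule oscillation_bound[OF k(1) S q8 k(3)])
    finally show "norm (X u) \<le> norm (X 0) + S * real (Suc k)" using k cSq by (simp add: algebra_simps)
  qed (use S0 in \<open>auto simp: mult_left_mono\<close>)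
  then show ?thesis by simp
qed

text \<open>No global S exists, so on each interval S is the maximum of |\<sigma>(X)|. The
  oscillation bound estimates it by its value at the left endpoint plus S/2, and the finiteness of S
  permits the absorption.\<close>

lemma linear_growth_bound:
  assumes q: "2 * c * (L * q n) \<le> 1" and u: "u \<in> {0..T}"
  shows "norm (X u) \<le> 2 ^ 2 ^ n * (norm (X 0) + norm (\<sigma> 0))"
proof -
  have Lq: "0 \<le> L * q n" "q n \<le> L * q n" using L q_nonneg[of n] mult_right_mono[of 1 L "q n"] by auto
  have "8 * (L * q n) \<le> 2 * c * (L * q n)" using c_ge Lq by (intro mult_right_mono) auto
  then have q8: "L * q n \<le> 1/8" using q by linarith
  have cont_\<sigma>: "continuous_on UNIV \<sigma>"
  proof (rule continuous_on_iff[THEN iffD2], intro ballI allI impI)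
    fix x and e :: real assume "e > 0"
    have "dist (\<sigma> y) (\<sigma> x) < e" if "dist y x < e / L" for y
    proof -
      have "L * norm (y - x) < e" using that L by (simp add: dist_norm field_simps)
      then show ?thesis using Lipschitz[of y x] by (simp add: dist_norm)
    qed
    then show "\<exists>d>0. \<forall>y\<in>UNIV. dist y x < d \<longrightarrow> dist (\<sigma> y) (\<sigma> x) < e"
      using \<open>e > 0\<close> L by (intro exI[of _ "e / L"]) auto
  qed
  \<comment> \<open>Adding a = |\<sigma>(0)| makes the affine growth of \<sigma> homogeneous: |X| +
    a at most doubles on each interval.\<close>
  define a where "a = norm (\<sigma> 0)"
  have "norm (X u) + a \<le> 2 ^ 2 ^ n * (norm (X 0) + a)"
  proof (rule propagate_bound[OF _ _ _ u])
    fix k u assume k: "k < 2 ^ n" "norm (X (dyad T n k)) + a \<le> 2 ^ k * (norm (X 0) + a)"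
      and u: "u \<in> {dyad T n k..dyad T n (Suc k)}"
    define s where "s = dyad T n k"
    define I where "I = {s..dyad T n (Suc k)}"
    have I: "compact I" "I \<noteq> {}" "s \<in> I" "I \<subseteq> {0..T}"
      using dyad_mono[of T k "Suc k" n] T dyad_in[of T k n] dyad_in[of T "Suc k" n] k(1)
      by (auto simp: I_def s_def)
    have "continuous_on I (\<lambda>v. norm (\<sigma> (X v)))"
      using I by (intro continuous_intros continuous_on_compose2[OF cont_\<sigma>] continuous_on_subset[OF cont_X]) auto
    then obtain v where v: "v \<in> I" "\<And>w. w \<in> I \<Longrightarrow> norm (\<sigma> (X w)) \<le> norm (\<sigma> (X v))"
      using continuous_attains_sup[OF I(1,2)] by blast
    define S where "S = norm (\<sigma> (X v))"
    have S0: "S \<ge> 0" by (simp add: S_def)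
    have osc: "norm (X w - X s) \<le> c * S * q n" if "w \<in> I" for w
      using oscillation_bound[OF k(1) _ q8] v(2) that unfolding I_def s_def S_def by blast
    have \<sigma>_s: "norm (\<sigma> (X s)) \<le> a + L * norm (X s)"
      using Lipschitz[of "X s" 0] norm_triangle_sub[of "\<sigma> (X s)" "\<sigma> 0"] by (simp add: a_def)
    have "S \<le> norm (\<sigma> (X s)) + norm (\<sigma> (X v) - \<sigma> (X s))"
      unfolding S_def using norm_triangle_sub by blast
    also have "\<dots> \<le> norm (\<sigma> (X s)) + L * norm (X v - X s)" using Lipschitz by simp
    also have "L * norm (X v - X s) \<le> L * (c * S * q n)" using osc[OF v(1)] L by (intro mult_left_mono) auto
    also have "\<dots> = (2 * c * (L * q n)) * (S / 2)" by simp
    also have "\<dots> \<le> 1 * (S / 2)" using q S0 by (intro mult_right_mono) auto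
    finally have "S \<le> 2 * (a + L * norm (X s))" using \<sigma>_s by simp
    then have "c * q n * S \<le> c * q n * (2 * (a + L * norm (X s)))"
      using c_ge q_nonneg by (intro mult_left_mono) auto
    also have "\<dots> = 2 * c * q n * a + 2 * c * (L * q n) * norm (X s)" by (simp add: algebra_simps)
    also have "\<dots> \<le> 1 * a + 1 * norm (X s)"
    proof (intro add_mono mult_right_mono q)
      have "2 * c * q n \<le> 2 * c * (L * q n)" using c_ge Lq by (intro mult_left_mono) auto
      then show "2 * c * q n \<le> 1" using q by linarith
    qed (auto simp: a_def)
    finally have "c * S * q n \<le> a + norm (X s)" by (simp add: mult_ac)
    moreover have "norm (X u) \<le> norm (X s) + norm (X u - X s)" using norm_triangle_sub by blast
    ultimately have "norm (X u) + a \<le> 2 * (norm (X s) + a)"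
      using osc[of u] u by (simp add: I_def s_def)
    also have "\<dots> \<le> 2 * (2 ^ k * (norm (X 0) + a))" using k(2) by (simp add: s_def)
    finally show "norm (X u) + a \<le> 2 ^ Suc k * (norm (X 0) + a)" by simp
  qed (auto simp: a_def)
  then show ?thesis by (simp add: a_def) (smt (verit) norm_ge_zero)
qed

end

text \<open>For the least admissible n > 0 the level m = n - 1 fails, that is, b > 2^(m \<beta>),
  whence 2^n = 2 * 2^m is at most 2 b^(1/\<beta>). The summand 1 covers n = 0.\<close>

lemma dyadic_scale_exists:
  fixes b \<beta> :: real
  assumes "b \<ge> 0" "\<beta> > 0"
  obtains n where "b * (2 powr - \<beta>) ^ n \<le> 1" "2 ^ n \<le> 1 + 2 * b powr (1 / \<beta>)"
proof -
  define \<rho> where "\<rho> = 2 powr - \<beta>"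
  have \<rho>: "0 < \<rho>" "\<rho> < 1" using \<open>\<beta> > 0\<close> powr_less_cancel_iff[of 2 "-\<beta>" 0] by (auto simp: \<rho>_def)
  have pow: "\<rho> ^ n = 1 / (2 ^ n) powr \<beta>" for n
  proof -
    have "\<rho> ^ n = 2 powr (- (real n * \<beta>))" by (simp add: \<rho>_def powr_power mult.commute)
    also have "\<dots> = 1 / (2 powr real n) powr \<beta>" by (simp add: powr_minus_divide powr_powr)
    finally show ?thesis by (simp add: powr_realpow)
  qed
  have "\<exists>n. b * \<rho> ^ n \<le> 1"
  proof -
    have "(\<lambda>n. b * \<rho> ^ n) \<longlonglongrightarrow> b * 0" using \<rho> by (intro tendsto_intros LIMSEQ_power_zero) auto
    then have "\<forall>\<^sub>F n in sequentially. b * \<rho> ^ n < 1" by (rule order_tendstoD) simp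
    then show ?thesis by (auto simp: eventually_sequentially intro: less_imp_le)
  qed
  define n where "n = (LEAST n. b * \<rho> ^ n \<le> 1)"
  have n: "b * \<rho> ^ n \<le> 1" unfolding n_def using \<open>\<exists>n. b * \<rho> ^ n \<le> 1\<close> by (rule LeastI_ex)
  have "2 ^ n \<le> 1 + 2 * b powr (1 / \<beta>)"
  proof (cases n)
    case 0
    then show ?thesis by simp
  next
    case (Suc m)
    then have "\<not> b * \<rho> ^ m \<le> 1" unfolding n_def using not_less_Least[of m "\<lambda>n. b * \<rho> ^ n \<le> 1"] by simp
    then have "(2 ^ m) powr \<beta> < b" by (simp add: pow field_simps)
    then have "((2 ^ m) powr \<beta>) powr (1 / \<beta>) \<le> b powr (1 / \<beta>)"
      using \<open>\<beta> > 0\<close> by (intro powr_mono2) auto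
    then have "2 ^ m \<le> b powr (1 / \<beta>)" using \<open>\<beta> > 0\<close> by (simp add: powr_powr)
    then show ?thesis using Suc by simp
  qed
  with n show ?thesis by (intro that[of n]) (simp_all add: \<rho>_def)
qed

section \<open>Gaussian control of the dyadic increments\<close>

lemma power_le_fact_exp:
  fixes x :: real
  assumes "x \<ge> 0"
  shows "x ^ n \<le> fact n * exp x"
proof -
  have "(\<Sum>i\<in>{n}. x ^ i /\<^sub>R fact i) \<le> exp x"
    unfolding exp_def using assms by (intro sum_le_suminf summable_exp_generic) auto
  then show ?thesis by (simp add: field_simps)
qed

text \<open>Multiplying the density of N(0, s^2) by exp(x^2 / (4 s^2)) halves its exponent and gives
  sqrt 2 times the density of N(0, 2 s^2).\<close>

lemma normal_exp_square:
  assumes D: "distributed M lborel Y (\<lambda>x. ennreal (normal_density 0 s x))" and s: "s > 0"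
  shows "(\<integral>\<^sup>+\<omega>. ennreal (exp ((Y \<omega>)\<^sup>2 / (4 * s\<^sup>2))) \<partial>M) = ennreal (sqrt 2)"
proof -
  have eq: "normal_density 0 s x * exp (x\<^sup>2 / (4 * s\<^sup>2)) = sqrt 2 * normal_density 0 (sqrt 2 * s) x" for x
  proof -
    have "exp (- x\<^sup>2 / (2 * s\<^sup>2)) * exp (x\<^sup>2 / (4 * s\<^sup>2)) = exp (- x\<^sup>2 / (4 * s\<^sup>2))"
      unfolding exp_add[symmetric] using s by (simp add: field_simps)
    moreover have "1 / sqrt (2 * pi * s\<^sup>2) = sqrt 2 * (1 / sqrt (2 * pi * (sqrt 2 * s)\<^sup>2))"
    proof -
      have *: "2 * pi * (sqrt 2 * s)\<^sup>2 = 2 * (2 * pi * s\<^sup>2)" by (simp add: power_mult_distrib)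
      show ?thesis unfolding * real_sqrt_mult[of 2 "2 * pi * s\<^sup>2"] by simp
    qed
    ultimately show ?thesis by (simp add: normal_density_def power_mult_distrib)
  qed
  have "(\<integral>\<^sup>+\<omega>. ennreal (exp ((Y \<omega>)\<^sup>2 / (4 * s\<^sup>2))) \<partial>M) =
      (\<integral>\<^sup>+x. ennreal (normal_density 0 s x) * ennreal (exp (x\<^sup>2 / (4 * s\<^sup>2))) \<partial>lborel)"
    by (rule distributed_nn_integral[OF D, symmetric]) simp
  also have "\<dots> = (\<integral>\<^sup>+x. ennreal (sqrt 2) * ennreal (normal_density 0 (sqrt 2 * s) x) \<partial>lborel)"
    by (intro nn_integral_cong) (simp add: eq flip: ennreal_mult)
  also have "\<dots> = ennreal (sqrt 2) * (\<integral>\<^sup>+x. ennreal (normal_density 0 (sqrt 2 * s) x) \<partial>lborel)"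
    by (rule nn_integral_cmult) simp
  also have "(\<integral>\<^sup>+x. ennreal (normal_density 0 (sqrt 2 * s) x) \<partial>lborel) = 1"
    using s by (subst nn_integral_eq_integral) auto
  finally show ?thesis by simp
qed

text \<open>With w = (Y/s)^2 the integrable function exp(w/4) is split in two: one factor exp(w/8)
  dominates w^N up to 8^N N!, the other dominates the exponential by the condition on a. The power
  leaves the small factor (s/b)^(2N).\<close>

lemma normal_power_exp_bound:
  assumes D: "distributed M lborel Y (\<lambda>x. ennreal (normal_density 0 s x))" and s: "s > 0"
    and b: "b > 0" and a: "a * (s / b)\<^sup>2 \<le> 1/8"
  shows "(\<integral>\<^sup>+\<omega>. ennreal ((Y \<omega> / b) ^ (2 * N) * exp (a * (Y \<omega> / b)\<^sup>2)) \<partial>M)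
     \<le> ennreal ((s / b) ^ (2 * N) * (8 ^ N * fact N * sqrt 2))"
proof -
  have [measurable]: "Y \<in> borel_measurable M" using distributed_measurable[OF D] by simp
  define \<tau> where "\<tau> = s / b"
  have \<tau>: "\<tau> > 0" using s b by (simp add: \<tau>_def)
  define C :: real where "C = \<tau> ^ (2 * N) * (8 ^ N * fact N)"
  have C: "C \<ge> 0" using \<tau> by (simp add: C_def)
  have "(y / b) ^ (2 * N) * exp (a * (y / b)\<^sup>2) \<le> C * exp (y\<^sup>2 / (4 * s\<^sup>2))" for y
  proof -
    define w where "w = (y / s)\<^sup>2"
    have w: "w \<ge> 0" by (simp add: w_def)
    have yb: "(y / b)\<^sup>2 = \<tau>\<^sup>2 * w" using s b by (simp add: \<tau>_def w_def power_divide)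
    have "(w / 8) ^ N \<le> fact N * exp (w / 8)" using w by (intro power_le_fact_exp) auto
    then have wN: "w ^ N \<le> 8 ^ N * fact N * exp (w / 8)" by (simp add: power_divide field_simps)
    have "a * (y / b)\<^sup>2 = (a * \<tau>\<^sup>2) * w" by (simp add: yb)
    also have "\<dots> \<le> 1/8 * w" using a w by (intro mult_right_mono) (auto simp: \<tau>_def)
    finally have e: "exp (a * (y / b)\<^sup>2) \<le> exp (w / 8)" by simp
    have "(y / b) ^ (2 * N) * exp (a * (y / b)\<^sup>2) = \<tau> ^ (2 * N) * w ^ N * exp (a * (y / b)\<^sup>2)"
      by (simp add: power_mult yb power_mult_distrib)
    also have "\<dots> \<le> \<tau> ^ (2 * N) * (8 ^ N * fact N * exp (w / 8)) * exp (w / 8)"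
      using \<tau> w wN e by (intro mult_mono mult_left_mono) auto
    also have "\<dots> = C * (exp (w / 8) * exp (w / 8))" by (simp add: C_def)
    also have "exp (w / 8) * exp (w / 8) = exp (y\<^sup>2 / (4 * s\<^sup>2))"
      by (simp add: w_def power_divide flip: exp_add)
    finally show ?thesis .
  qed
  then have "(\<integral>\<^sup>+\<omega>. ennreal ((Y \<omega> / b) ^ (2 * N) * exp (a * (Y \<omega> / b)\<^sup>2)) \<partial>M)
      \<le> (\<integral>\<^sup>+\<omega>. ennreal (C * exp ((Y \<omega>)\<^sup>2 / (4 * s\<^sup>2))) \<partial>M)"
    by (intro nn_integral_mono ennreal_leI) auto
  also have "\<dots> = (\<integral>\<^sup>+\<omega>. ennreal C * ennreal (exp ((Y \<omega>)\<^sup>2 / (4 * s\<^sup>2))) \<partial>M)"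
    using C by (simp add: ennreal_mult)
  also have "\<dots> = ennreal C * ennreal (sqrt 2)"
    using normal_exp_square[OF D s] by (subst nn_integral_cmult) auto
  also have "\<dots> = ennreal ((s / b) ^ (2 * N) * (8 ^ N * fact N * sqrt 2))"
    using C by (simp add: C_def \<tau>_def mult_ac flip: ennreal_mult)
  finally show ?thesis .
qed

section \<open>Gaussian increments of fractional Brownian motion\<close>

context prob_space
begin

text \<open>Integrability must come from the Gaussian law: a Bochner integral of a non-integrable
  function is 0 by convention, so prescribed means and covariances alone do not guarantee that the
  moments exist or that integrals may be added.\<close>

lemma gaussian_rv_integrable:
  assumes "gaussian_rv M Y"
  shows "integrable M Y" "integrable M (\<lambda>\<omega>. (Y \<omega>)\<^sup>2)"
proof -
  have [measurable]: "Y \<in> borel_measurable M" using assms by (simp add: gaussian_rv_def)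
  consider \<mu> s where "s > 0" "distributed M lborel Y (\<lambda>x. ennreal (normal_density \<mu> s x))"
    | c where "AE \<omega> in M. Y \<omega> = c"
    using assms unfolding gaussian_rv_def by blast
  then have "integrable M Y \<and> integrable M (\<lambda>\<omega>. (Y \<omega>)\<^sup>2)"
  proof cases
    case (1 \<mu> s)
    have 1: "integrable lborel (\<lambda>x. normal_density \<mu> s x * x)"
      using 1 by (intro integrable_normal_moment_nz_1) auto
    have "integrable lborel (\<lambda>x. normal_density \<mu> s x * (x - \<mu>)^2 + 2 * \<mu> * (normal_density \<mu> s x * x)
         - \<mu>\<^sup>2 * normal_density \<mu> s x)"
      using \<open>s > 0\<close> 1 by (intro Bochner_Integration.integrable_add Bochner_Integration.integrable_diff
        integrable_mult_right integrable_normal_moment integrable_normal_density) auto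
    also have "(\<lambda>x. normal_density \<mu> s x * (x - \<mu>)^2 + 2 * \<mu> * (normal_density \<mu> s x * x)
         - \<mu>\<^sup>2 * normal_density \<mu> s x) = (\<lambda>x. normal_density \<mu> s x * x\<^sup>2)"
      by (auto simp: power2_eq_square algebra_simps)
    finally have 2: "integrable lborel (\<lambda>x. normal_density \<mu> s x * x\<^sup>2)" .
    from 1 2 show ?thesis
      using distributed_integrable[OF \<open>distributed M lborel Y _\<close>, of "\<lambda>x. x"]
        distributed_integrable[OF \<open>distributed M lborel Y _\<close>, of "\<lambda>x. x\<^sup>2"] by simp
  next
    case (2 c)
    have "integrable M Y \<longleftrightarrow> integrable M (\<lambda>_. c)" by (intro integrable_cong_AE) (use 2 in auto)
    moreover have "integrable M (\<lambda>\<omega>. (Y \<omega>)\<^sup>2) \<longleftrightarrow> integrable M (\<lambda>_. c\<^sup>2)"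
      by (intro integrable_cong_AE) (use 2 in auto)
    ultimately show ?thesis by simp
  qed
  then show "integrable M Y" "integrable M (\<lambda>\<omega>. (Y \<omega>)\<^sup>2)" by auto
qed

text \<open>Mean and variance identify the parameters of the density, and a positive variance
  excludes the degenerate alternative of an almost surely constant variable.\<close>

lemma gaussian_rv_centered:
  assumes Y: "gaussian_rv M Y" and mean: "expectation Y = 0"
    and var: "expectation (\<lambda>\<omega>. (Y \<omega>)\<^sup>2) = v\<^sup>2" and "v > 0"
  shows "distributed M lborel Y (\<lambda>x. ennreal (normal_density 0 v x))"
proof -
  have [measurable]: "Y \<in> borel_measurable M" using Y by (simp add: gaussian_rv_def)
  consider \<mu> s where "s > 0" "distributed M lborel Y (\<lambda>x. ennreal (normal_density \<mu> s x))"
    | c where "AE \<omega> in M. Y \<omega> = c"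
    using Y unfolding gaussian_rv_def by blast
  then show ?thesis
  proof cases
    case (1 \<mu> s)
    have "expectation Y = \<mu>"
      using distributed_integral[OF 1(2), of "\<lambda>x. x"] integral_normal_moment_nz_1[OF 1(1), of \<mu>] by simp
    then have \<mu>: "\<mu> = 0" using mean by simp
    have "expectation (\<lambda>\<omega>. (Y \<omega>)\<^sup>2) = s\<^sup>2"
      using distributed_integral[OF 1(2), of "\<lambda>x. x\<^sup>2"] integral_normal_moment_even[OF 1(1), of 0 1] \<mu>
      by (simp add: numeral_2_eq_2)
    then have "s = v" using var \<open>s > 0\<close> \<open>v > 0\<close> by (simp add: power2_eq_iff_nonneg)
    then show ?thesis using 1 \<mu> by simp
  next
    case (2 c)
    have "expectation Y = expectation (\<lambda>_. c)" by (intro integral_cong_AE) (use 2 in auto)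
    then have "c = 0" using mean by (simp add: prob_space)
    have "expectation (\<lambda>\<omega>. (Y \<omega>)\<^sup>2) = expectation (\<lambda>_. c\<^sup>2)" by (intro integral_cong_AE) (use 2 in auto)
    then show ?thesis using var \<open>c = 0\<close> \<open>v > 0\<close> by simp
  qed
qed

lemma gaussian_process_component:
  assumes "gaussian_process M B" "t \<ge> 0"
  shows "gaussian_rv M (\<lambda>\<omega>. B t \<omega> $ j)"
proof -
  have "gaussian_rv M (\<lambda>\<omega>. \<Sum>u\<in>{t}. \<Sum>i\<in>UNIV. (if i = j then 1 else 0) * B u \<omega> $ i)"
    using assms unfolding gaussian_process_def
    by (elim conjE allE[of _ "{t}"] allE[of _ "\<lambda>_ i. if i = j then 1 else 0"]) auto
  then show ?thesis by (simp add: if_distrib[of "\<lambda>x. x * _"] cong: if_cong)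
qed

text \<open>The increment is Gaussian as a linear combination at the two times s and t, and R(t,t) -
  2 R(t,s) + R(s,s) = (t - s)^(2H).\<close>

lemma fbm_increment_distributed:
  assumes B: "fractional_brownian_motion M H B" and st: "0 \<le> s" "s < t"
  shows "distributed M lborel (\<lambda>\<omega>. B t \<omega> $ j - B s \<omega> $ j)
    (\<lambda>x. ennreal (normal_density 0 ((t - s) powr H) x))"
proof (rule gaussian_rv_centered)
  have gp: "gaussian_process M B" using B by (simp add: fractional_brownian_motion_def)
  have "gaussian_rv M (\<lambda>\<omega>. \<Sum>u\<in>{s, t}. \<Sum>i\<in>UNIV.
      (if i = j then if u = t then 1 else -1 else 0) * B u \<omega> $ i)"
    using gp st unfolding gaussian_process_def
    by (elim conjE allE[of _ "{s, t}"] allE[of _ "\<lambda>u i. if i = j then if u = t then 1 else -1 else 0"]) auto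
  then show "gaussian_rv M (\<lambda>\<omega>. B t \<omega> $ j - B s \<omega> $ j)"
    using st by (simp add: if_distrib[of "\<lambda>x. x * _"] cong: if_cong)
  let ?b = "\<lambda>u \<omega>. B u \<omega> $ j"
  have int: "integrable M (?b u)" "integrable M (\<lambda>\<omega>. (?b u \<omega>)\<^sup>2)" if "u \<ge> 0" for u
    using gaussian_rv_integrable[OF gaussian_process_component[OF gp that]] by auto
  have [measurable]: "?b t \<in> borel_measurable M" "?b s \<in> borel_measurable M"
    using int(1)[of t] int(1)[of s] st by auto
  have int_prod: "integrable M (\<lambda>\<omega>. ?b t \<omega> * ?b s \<omega>)"
  proof (rule Bochner_Integration.integrable_bound)
    show "integrable M (\<lambda>\<omega>. (?b t \<omega>)\<^sup>2 + (?b s \<omega>)\<^sup>2)" using int st by auto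
    have "\<bar>x * y\<bar> \<le> x\<^sup>2 + y\<^sup>2" for x y :: real
      using sum_squares_bound[of "\<bar>x\<bar>" "\<bar>y\<bar>"] mult_nonneg_nonneg[OF abs_ge_zero[of x] abs_ge_zero[of y]]
      unfolding abs_mult power2_abs by linarith
    then show "AE \<omega> in M. norm (?b t \<omega> * ?b s \<omega>) \<le> norm ((?b t \<omega>)\<^sup>2 + (?b s \<omega>)\<^sup>2)" by simp
  qed simp
  show "expectation (\<lambda>\<omega>. B t \<omega> $ j - B s \<omega> $ j) = 0"
    using int st B by (simp add: fractional_brownian_motion_def)
  have cov: "expectation (\<lambda>\<omega>. ?b u \<omega> * ?b v \<omega>) = fbm_cov H u v" if "u \<ge> 0" "v \<ge> 0" for u v
    using B that by (simp add: fractional_brownian_motion_def)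
  have "expectation (\<lambda>\<omega>. (?b t \<omega> - ?b s \<omega>)\<^sup>2) =
      expectation (\<lambda>\<omega>. (?b t \<omega>)\<^sup>2 - 2 * (?b t \<omega> * ?b s \<omega>) + (?b s \<omega>)\<^sup>2)"
    by (intro Bochner_Integration.integral_cong) (auto simp: power2_eq_square algebra_simps)
  also have "\<dots> = expectation (\<lambda>\<omega>. (?b t \<omega>)\<^sup>2) - 2 * expectation (\<lambda>\<omega>. ?b t \<omega> * ?b s \<omega>)
      + expectation (\<lambda>\<omega>. (?b s \<omega>)\<^sup>2)"
    using int st int_prod by simp
  also have "\<dots> = fbm_cov H t t - 2 * fbm_cov H t s + fbm_cov H s s"
    using cov[of t t] cov[of t s] cov[of s s] st by (simp add: power2_eq_square)
  also have "\<dots> = ((t - s) powr H)\<^sup>2"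
    using st by (simp add: fbm_cov_def powr_power mult.commute diff_divide_distrib add_divide_distrib)
  finally show "expectation (\<lambda>\<omega>. (B t \<omega> $ j - B s \<omega> $ j)\<^sup>2) = ((t - s) powr H)\<^sup>2" .
  show "(t - s) powr H > 0" using st by simp
qed

text \<open>\<open>G\<close> is \<open>e\<^sup>a\<close> plus the sum of \<open>y\<^sup>2\<^sup>N exp (a y\<^sup>2)\<close> over all normalised dyadic increments \<open>y\<close>.
  The power \<open>2N\<close> makes the expectations decay faster than the number of intervals grows.\<close>

lemma fbm_dyadic_modulus:
  fixes B :: "real \<Rightarrow> 'a \<Rightarrow> real ^ 'm"
  assumes B: "fractional_brownian_motion M H B" and T: "T > 0" and \<beta>: "\<beta> < H"
  obtains a G where "a > 0" "integrable M G" "\<And>\<omega>. G \<omega> \<ge> 1"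
    "AE \<omega> in M. \<forall>n k j. k < 2 ^ n \<longrightarrow>
       exp (a * ((B (dyad T n (Suc k)) \<omega> $ j - B (dyad T n k) \<omega> $ j) / (T / 2 ^ n) powr \<beta>)\<^sup>2) \<le> G \<omega>"
proof -
  define \<epsilon> where "\<epsilon> = H - \<beta>"
  have \<epsilon>: "\<epsilon> > 0" using \<beta> by (simp add: \<epsilon>_def)
  \<comment> \<open>A normalised increment over length h has standard deviation h^\<epsilon>, at
    most T^\<epsilon>; this a is the largest for which \<open>normal_power_exp_bound\<close> applies
    at all levels at once.\<close>
  define a where "a = 1 / (8 * (T powr \<epsilon>)\<^sup>2)"
  have a: "a > 0" using T by (simp add: a_def)
  \<comment> \<open>This gives 2 N \<epsilon> \<ge> 2, hence expectations of order 4^(-n) against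
    the 2^n intervals of level n.\<close>
  obtain N :: nat where N: "1 / \<epsilon> \<le> real N" using real_arch_simple by blast
  define h where "h = (\<lambda>n::nat. T / 2 ^ n)"
  have h: "h n > 0" "h n \<le> T" for n using T by (auto simp: h_def field_simps)
  define D where "D = (\<lambda>n k j \<omega>. B (dyad T n (Suc k)) \<omega> $ j - B (dyad T n k) \<omega> $ j)"
  define f where "f = (\<lambda>n k j \<omega>. (D n k j \<omega> / h n powr \<beta>) ^ (2 * N) * exp (a * (D n k j \<omega> / h n powr \<beta>)\<^sup>2))"
  have f_nonneg: "f n k j \<omega> \<ge> 0" for n k j \<omega> by (simp add: f_def)
  define C :: real where "C = 8 ^ N * fact N * sqrt 2"
  have C: "C \<ge> 0" by (simp add: C_def)
  have dist: "distributed M lborel (D n k j) (\<lambda>x. ennreal (normal_density 0 (h n powr H) x))" for n k j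
  proof -
    have "0 \<le> dyad T n k" "dyad T n k < dyad T n (Suc k)"
      using T dyad_diff[of T n k] by (auto simp: dyad_def divide_strict_right_mono)
    from fbm_increment_distributed[OF B this, of j] show ?thesis
      unfolding D_def h_def dyad_diff .
  qed
  have [measurable]: "D n k j \<in> borel_measurable M" for n k j
    using distributed_measurable[OF dist[of n k j]] by simp
  have f_int: "(\<integral>\<^sup>+\<omega>. ennreal (f n k j \<omega>) \<partial>M) \<le> ennreal (C * (T powr (2 * real N * \<epsilon>)) * (1/4) ^ n)" for n k j
  proof -
    have ratio: "h n powr H / h n powr \<beta> = h n powr \<epsilon>" by (simp add: \<epsilon>_def powr_diff)
    have "(h n powr \<epsilon>)\<^sup>2 \<le> (T powr \<epsilon>)\<^sup>2" using h[of n] \<epsilon> by (intro power_mono powr_mono2) auto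
    then have "a * (h n powr \<epsilon>)\<^sup>2 \<le> a * (T powr \<epsilon>)\<^sup>2" using a by (intro mult_left_mono) auto
    also have "\<dots> = 1/8" using T by (simp add: a_def)
    finally have "a * (h n powr H / h n powr \<beta>)\<^sup>2 \<le> 1/8" by (simp add: ratio)
    then have "(\<integral>\<^sup>+\<omega>. ennreal (f n k j \<omega>) \<partial>M) \<le> ennreal ((h n powr \<epsilon>) ^ (2 * N) * C)"
      using normal_power_exp_bound[OF dist[of n k j], of "h n powr \<beta>" a N] h[of n]
      unfolding f_def ratio C_def by simp
    also have "\<dots> \<le> ennreal (C * (T powr (2 * real N * \<epsilon>)) * (1/4) ^ n)"
    proof (rule ennreal_leI)
      define z where "z = 2 * real N * \<epsilon>"
      have z: "2 \<le> z" using N \<epsilon> by (simp add: z_def field_simps)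
      have "(h n powr \<epsilon>) ^ (2 * N) = h n powr z" using h(1)[of n] by (simp add: powr_power z_def mult_ac)
      also have "\<dots> = T powr z * ((1/2) ^ n) powr z"
        using T by (simp add: h_def powr_mult[symmetric] power_one_over)
      also have "((1/2) ^ n) powr z \<le> ((1/2::real) ^ n) powr 2"
        using z by (intro powr_mono') (auto simp: power_le_one)
      also have "((1/2::real) ^ n) powr 2 = (1/4) ^ n"
        by (simp add: power2_eq_square flip: power_mult_distrib)
      finally have "(h n powr \<epsilon>) ^ (2 * N) \<le> T powr z * (1/4) ^ n"
        by (simp add: mult_left_mono)
      then have "(h n powr \<epsilon>) ^ (2 * N) * C \<le> (T powr z * (1/4) ^ n) * C" using C by (rule mult_right_mono)
      then show "(h n powr \<epsilon>) ^ (2 * N) * C \<le> C * T powr (2 * real N * \<epsilon>) * (1/4) ^ n"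
        by (simp add: z_def mult_ac)
    qed
    finally show ?thesis .
  qed
  \<comment> \<open>Taken in the extended nonnegative reals, the series can be integrated termwise
    before its convergence is known.\<close>
  define W where "W = (\<lambda>\<omega>. \<Sum>n. ennreal (\<Sum>k<2^n. \<Sum>j\<in>UNIV. f n k j \<omega>))"
  have [measurable]: "f n k j \<in> borel_measurable M" for n k j unfolding f_def by measurable
  have [measurable]: "W \<in> borel_measurable M" unfolding W_def by measurable
  define C' where "C' = real CARD('m) * (C * T powr (2 * real N * \<epsilon>))"
  have C': "C' \<ge> 0" using C by (simp add: C'_def)
  have "integral\<^sup>N M W = (\<Sum>n. \<integral>\<^sup>+\<omega>. ennreal (\<Sum>k<2^n. \<Sum>j\<in>UNIV. f n k j \<omega>) \<partial>M)"
    unfolding W_def by (intro nn_integral_suminf) measurable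
  also have "\<dots> \<le> (\<Sum>n. ennreal (C' * (1/2) ^ n))"
  proof (intro suminf_le allI summableI)
    fix n
    have "(\<integral>\<^sup>+\<omega>. ennreal (\<Sum>k<2^n. \<Sum>j\<in>UNIV. f n k j \<omega>) \<partial>M) =
        (\<integral>\<^sup>+\<omega>. (\<Sum>k<2^n. \<Sum>j\<in>UNIV. ennreal (f n k j \<omega>)) \<partial>M)"
      by (intro nn_integral_cong) (simp add: f_nonneg sum_nonneg flip: sum_ennreal)
    also have "\<dots> = (\<Sum>k<2^n. \<Sum>j\<in>UNIV. \<integral>\<^sup>+\<omega>. ennreal (f n k j \<omega>) \<partial>M)"
      by (subst nn_integral_sum, measurable) (intro sum.cong refl nn_integral_sum, measurable)
    also have "\<dots> \<le> (\<Sum>k<(2::nat)^n. \<Sum>j\<in>(UNIV::'m set). ennreal (C * (T powr (2 * real N * \<epsilon>)) * (1/4) ^ n))"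
      by (intro sum_mono f_int)
    also have "\<dots> = ennreal (\<Sum>k<(2::nat)^n. \<Sum>j\<in>(UNIV::'m set). C * (T powr (2 * real N * \<epsilon>)) * (1/4) ^ n)"
      using C by (simp add: sum_nonneg del: sum_constant)
    also have "(\<Sum>k<(2::nat)^n. \<Sum>j\<in>(UNIV::'m set). C * (T powr (2 * real N * \<epsilon>)) * (1/4) ^ n) = C' * (1/2) ^ n"
      by (simp add: C'_def power_one_over field_simps flip: power_mult_distrib)
    finally show "(\<integral>\<^sup>+\<omega>. ennreal (\<Sum>k<2^n. \<Sum>j\<in>UNIV. f n k j \<omega>) \<partial>M) \<le> ennreal (C' * (1/2) ^ n)" .
  qed
  also have "\<dots> = ennreal (\<Sum>n. C' * (1/2) ^ n)"
    using C' by (intro suminf_ennreal2 summable_mult summable_geometric) auto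
  also have "\<dots> < \<infinity>" by simp
  finally have W_fin: "integral\<^sup>N M W < \<infinity>" .
  have W_AE: "AE \<omega> in M. W \<omega> \<noteq> \<infinity>" using W_fin by (intro nn_integral_PInf_AE) auto
  \<comment> \<open>The summand \<open>exp a\<close> covers increments with y^2 \<le> 1, for which
    y^(2N) may be small, and makes G at least 1. On the null set where W is infinite,
    \<open>enn2real\<close> returns 0.\<close>
  define G where "G = (\<lambda>\<omega>. exp a + enn2real (W \<omega>))"
  show ?thesis
  proof (rule that[of a G])
    have "integrable M (\<lambda>\<omega>. enn2real (W \<omega>))"
    proof (rule integrableI_bounded)
      have "(\<integral>\<^sup>+\<omega>. ennreal (norm (enn2real (W \<omega>))) \<partial>M) \<le> integral\<^sup>N M W"
        by (intro nn_integral_mono) (metis enn2real_nonneg ennreal_enn2real_if order_refl real_norm_def abs_of_nonneg zero_le ennreal_0)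
      then show "(\<integral>\<^sup>+\<omega>. ennreal (norm (enn2real (W \<omega>))) \<partial>M) < \<infinity>" using W_fin by (rule le_less_trans)
    qed measurable
    then show "integrable M G" by (simp add: G_def)
    show "G \<omega> \<ge> 1" for \<omega>
      unfolding G_def using enn2real_nonneg[of "W \<omega>"] a one_le_exp_iff[of a] by linarith
    show "AE \<omega> in M. \<forall>n k j. k < 2 ^ n \<longrightarrow>
       exp (a * ((B (dyad T n (Suc k)) \<omega> $ j - B (dyad T n k) \<omega> $ j) / (T / 2 ^ n) powr \<beta>)\<^sup>2) \<le> G \<omega>"
      using W_AE
    proof eventually_elim
      case (elim \<omega>)
      show ?case
      proof (intro allI impI)
        fix n k j assume k: "k < (2::nat) ^ n"
        define y where "y = D n k j \<omega> / h n powr \<beta>"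
        have "f n k j \<omega> \<le> (\<Sum>j\<in>UNIV. f n k j \<omega>)" by (intro member_le_sum f_nonneg) auto
        also have "\<dots> \<le> (\<Sum>k<2^n. \<Sum>j\<in>UNIV. f n k j \<omega>)"
          using k by (intro member_le_sum[of k _ "\<lambda>k. \<Sum>j\<in>UNIV. f n k j \<omega>"] sum_nonneg f_nonneg) auto
        finally have "ennreal (f n k j \<omega>) \<le> ennreal (\<Sum>k<2^n. \<Sum>j\<in>UNIV. f n k j \<omega>)" by (rule ennreal_leI)
        also have "\<dots> \<le> W \<omega>"
          unfolding W_def
          using sum_le_suminf[of "\<lambda>n. ennreal (\<Sum>k<2^n. \<Sum>j\<in>UNIV. f n k j \<omega>)" "{n}"] by simp
        finally have fW: "f n k j \<omega> \<le> enn2real (W \<omega>)"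
          using elim by (cases "W \<omega>") (auto simp: top_unique enn2real_ennreal ennreal_le_iff)
        have "exp (a * y\<^sup>2) \<le> G \<omega>"
        proof (cases "y\<^sup>2 \<le> 1")
          case True
          then have "exp (a * y\<^sup>2) \<le> exp a" using a mult_left_mono[of "y\<^sup>2" 1 a] by simp
          then show ?thesis unfolding G_def using enn2real_nonneg[of "W \<omega>"] by linarith
        next
          case False
          then have "1 \<le> y ^ (2 * N)" using one_le_power[of "y\<^sup>2" N] by (simp add: power_mult)
          then have "1 * exp (a * y\<^sup>2) \<le> y ^ (2 * N) * exp (a * y\<^sup>2)" by (intro mult_right_mono) auto
          also have "\<dots> = f n k j \<omega>" by (simp add: f_def y_def)
          finally show ?thesis unfolding G_def using fW exp_ge_zero[of a] by linarith
        qed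
        then show "exp (a * ((B (dyad T n (Suc k)) \<omega> $ j - B (dyad T n k) \<omega> $ j) / (T / 2 ^ n) powr \<beta>)\<^sup>2) \<le> G \<omega>"
          by (simp add: y_def D_def h_def)
      qed
    qed
  qed (rule a)
qed

end

section \<open>Moment bounds for the solution\<close>

text \<open>The requirement on one path, separated from the measure: the analytic estimates are
  deterministic and are applied to almost every path afterwards.\<close>

definition RS_solution ::
    "real \<Rightarrow> (real ^ 'd \<Rightarrow> real ^ 'm ^ 'd) \<Rightarrow> real ^ 'd \<Rightarrow> (real \<Rightarrow> real ^ 'm) \<Rightarrow> (real \<Rightarrow> real ^ 'd) \<Rightarrow> bool" where
  "RS_solution T \<sigma> x0 b x \<longleftrightarrow> continuous_on {0..T} x \<and>
     (\<forall>t\<in>{0..T}. \<exists>I. (\<forall>i j. has_RS_integral (\<lambda>s. \<sigma> (x s) $ i $ j) (\<lambda>s. b s $ j) (I i j) 0 t) \<and>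
        (\<forall>i. x t $ i = x0 $ i + (\<Sum>j\<in>UNIV. I i j)))"

lemma RS_solution_initial:
  assumes "RS_solution T \<sigma> x0 b x" "T > 0"
  shows "x 0 = x0"
proof -
  have "0 \<in> {0..T}" using \<open>T > 0\<close> by simp
  then obtain I where I: "\<And>i j. has_RS_integral (\<lambda>s. \<sigma> (x s) $ i $ j) (\<lambda>s. b s $ j) (I i j) 0 0"
    "\<And>i. x 0 $ i = x0 $ i + (\<Sum>j\<in>UNIV. I i j)"
    using assms unfolding RS_solution_def by meson
  have "I i j = 0" for i j using has_RS_integral_refl_eq[OF I(1)] .
  then show ?thesis using I(2) by (simp add: vec_eq_iff)
qed

text \<open>The i-th coordinate of a remainder is minus the sum over j of the scalar integration
  errors. The integrals are given separately for each t, so a choice first makes them functions of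
  t, to which the scalar result applies.\<close>

lemma RS_solution_Euler_errors:
  fixes \<sigma> :: "real ^ 'd \<Rightarrow> real ^ 'm ^ 'd"
  assumes sol: "RS_solution T \<sigma> x0 b x" and T: "T > 0"
  shows "(\<lambda>n. \<Sum>k<2^n. norm (x (dyad T n (Suc k)) - x (dyad T n k)
          - \<sigma> (x (dyad T n k)) *v (b (dyad T n (Suc k)) - b (dyad T n k)))) \<longlonglongrightarrow> 0"
proof -
  have "\<forall>t. \<exists>I. t \<in> {0..T} \<longrightarrow> (\<forall>i j. has_RS_integral (\<lambda>s. \<sigma> (x s) $ i $ j) (\<lambda>s. b s $ j) (I i j) 0 t) \<and>
        (\<forall>i. x t $ i = x0 $ i + (\<Sum>j\<in>UNIV. I i j))"
    using sol unfolding RS_solution_def by blast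
  then obtain I where I: "\<And>t i j. t \<in> {0..T} \<Longrightarrow>
      has_RS_integral (\<lambda>s. \<sigma> (x s) $ i $ j) (\<lambda>s. b s $ j) (I t i j) 0 t"
    "\<And>t i. t \<in> {0..T} \<Longrightarrow> x t $ i = x0 $ i + (\<Sum>j\<in>UNIV. I t i j)"
    by metis
  define e where "e = (\<lambda>n k i j. \<bar>\<sigma> (x (dyad T n k)) $ i $ j * (b (dyad T n (Suc k)) $ j - b (dyad T n k) $ j)
      - (I (dyad T n (Suc k)) i j - I (dyad T n k) i j)\<bar>)"
  have "(\<lambda>n. \<Sum>k<2^n. e n k i j) \<longlonglongrightarrow> 0" for i j
    unfolding e_def by (rule RS_dyadic_errors_tendsto_0[OF I(1) T])
  then have lim: "(\<lambda>n. \<Sum>i\<in>UNIV. \<Sum>j\<in>UNIV. \<Sum>k<2^n. e n k i j) \<longlonglongrightarrow> 0"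
    by (intro tendsto_null_sum)
  have bound: "norm (x (dyad T n (Suc k)) - x (dyad T n k)
      - \<sigma> (x (dyad T n k)) *v (b (dyad T n (Suc k)) - b (dyad T n k))) \<le> (\<Sum>i\<in>UNIV. \<Sum>j\<in>UNIV. e n k i j)"
    (is "norm ?v \<le> _") if "k < 2 ^ n" for n k
  proof -
    have "dyad T n k \<in> {0..T}" "dyad T n (Suc k) \<in> {0..T}" using that T by (auto intro!: dyad_in simp del: atLeastAtMost_iff)
    then have "?v $ i = - (\<Sum>j\<in>UNIV. \<sigma> (x (dyad T n k)) $ i $ j * (b (dyad T n (Suc k)) $ j - b (dyad T n k) $ j)
      - (I (dyad T n (Suc k)) i j - I (dyad T n k) i j))" for i
      using I(2) by (simp add: matrix_vector_mult_def sum_subtractf)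
    then have "\<bar>?v $ i\<bar> \<le> (\<Sum>j\<in>UNIV. e n k i j)" for i
      unfolding e_def by (simp only: abs_minus_cancel sum_abs)
    then show ?thesis by (intro order_trans[OF norm_le_l1_cart] sum_mono)
  qed
  show ?thesis
  proof (rule tendsto_sandwich[OF _ _ tendsto_const lim])
    have "(\<Sum>i\<in>UNIV. \<Sum>j\<in>UNIV. \<Sum>k<2^n. e n k i j) = (\<Sum>k<2^n. \<Sum>i\<in>UNIV. \<Sum>j\<in>UNIV. e n k i j)" for n
      by (subst (2) sum.swap) (intro sum.cong refl sum.swap)
    then show "\<forall>\<^sub>F n in sequentially. (\<Sum>k<2^n. norm (x (dyad T n (Suc k)) - x (dyad T n k)
        - \<sigma> (x (dyad T n k)) *v (b (dyad T n (Suc k)) - b (dyad T n k))))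
       \<le> (\<Sum>i\<in>UNIV. \<Sum>j\<in>UNIV. \<Sum>k<2^n. e n k i j)"
      using bound by (auto intro!: always_eventually sum_mono)
  qed (auto intro!: always_eventually sum_nonneg)
qed

text \<open>C is fixed before K and the path, so that K may later vary with the sample point. K
  enters only through the number 2^n of intervals.\<close>

lemma RS_solution_bounds:
  fixes \<sigma> :: "real ^ 'd \<Rightarrow> real ^ 'm ^ 'd"
  assumes T: "T > 0" and L: "L \<ge> 1" and \<beta>: "\<beta> > 1/2"
    and Lipschitz: "\<And>x y. norm (\<sigma> x - \<sigma> y) \<le> L * norm (x - y)"
  obtains C where "C \<ge> 0"
    "\<And>K x0 b x u. \<lbrakk>K \<ge> 0; RS_solution T \<sigma> x0 b x; u \<in> {0..T};
       \<And>n k j. k < 2 ^ n \<Longrightarrow> \<bar>b (dyad T n (Suc k)) $ j - b (dyad T n k) $ j\<bar> \<le> K * (T / 2 ^ n) powr \<beta>\<rbrakk>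
       \<Longrightarrow> norm (x u) \<le> 2 powr (1 + C * K powr (1 / \<beta>)) * (norm x0 + norm (\<sigma> 0)) \<and>
         (\<forall>S. (\<forall>y. norm (\<sigma> y) \<le> S) \<longrightarrow> norm (x u) \<le> norm x0 + S * (1 + C * K powr (1 / \<beta>)))"
proof -
  define \<rho> where "\<rho> = 2 powr - \<beta>"
  define m where "m = real CARD('m)"
  define c where "c = dyadic_equation.c \<rho>"
  have \<rho>2: "2 * \<rho>\<^sup>2 = 2 powr (1 - 2 * \<beta>)"
    using powr_add[of 2 1 "- \<beta> + - \<beta>"] by (simp add: \<rho>_def power2_eq_square flip: powr_add)
  also have "\<dots> < 2 powr 0" using \<beta> by (intro powr_less_mono) auto
  finally have \<rho>sq: "2 * \<rho>\<^sup>2 < 1" by simp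
  \<comment> \<open>Here 1/2 < 9/16 is what makes 3/4 a valid bound for every \<beta> > 1/2.\<close>
  then have "\<rho>\<^sup>2 \<le> (3/4)\<^sup>2" by (simp add: power_divide)
  then have \<rho>34: "\<rho> \<le> 3/4" by (rule power2_le_imp_le) simp
  have \<rho>0: "0 < \<rho>" by (simp add: \<rho>_def)
  \<comment> \<open>\<open>dyadic_scale_exists\<close> is applied to 2 c L q_0 with q_0 = m K
    T^\<beta>, and K^(1/\<beta>) is split off. The m coordinates enter through the l1 bound on the
    Euclidean norm; c depends on \<rho> alone.\<close>
  define C where "C = 2 * (2 * c * L * (m * T powr \<beta>)) powr (1 / \<beta>)"
  show ?thesis
  proof (rule that[of C])
    show "C \<ge> 0" by (simp add: C_def)
  next
    fix K x0 b x u
    assume K: "K \<ge> 0" and sol: "RS_solution T \<sigma> x0 b x" and u: "u \<in> {0..T}"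
      and incr: "\<And>n k j. k < 2 ^ n \<Longrightarrow> \<bar>b (dyad T n (Suc k)) $ j - b (dyad T n k) $ j\<bar> \<le> K * (T / 2 ^ n) powr \<beta>"
    define q\<^sub>0 where "q\<^sub>0 = m * K * T powr \<beta>"
    have pow: "(T / 2 ^ n) powr \<beta> = T powr \<beta> * \<rho> ^ n" for n
    proof -
      have "\<rho> ^ n = 2 powr (- (real n * \<beta>))" by (simp add: \<rho>_def powr_power mult.commute)
      also have "\<dots> = 1 / (2 powr real n) powr \<beta>" by (simp add: powr_minus_divide powr_powr)
      finally show ?thesis using T by (simp add: powr_realpow powr_divide)
    qed
    interpret dyadic: dyadic_equation x b \<sigma> T L q\<^sub>0 \<rho>
    proof
      show "continuous_on {0..T} x" using sol by (simp add: RS_solution_def)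
      show "(\<lambda>n. \<Sum>k<2^n. norm (x (dyad T n (Suc k)) - x (dyad T n k)
          - \<sigma> (x (dyad T n k)) *v (b (dyad T n (Suc k)) - b (dyad T n k)))) \<longlonglongrightarrow> 0"
        by (rule RS_solution_Euler_errors[OF sol T])
      fix k n :: nat assume k: "k < 2 ^ n"
      have "norm (b (dyad T n (Suc k)) - b (dyad T n k)) \<le> (\<Sum>j\<in>(UNIV::'m set). K * (T / 2 ^ n) powr \<beta>)"
        using incr[OF k] by (intro order_trans[OF norm_le_l1_cart] sum_mono) simp
      then show "norm (b (dyad T n (Suc k)) - b (dyad T n k)) \<le> q\<^sub>0 * \<rho> ^ n"
        by (simp add: q\<^sub>0_def m_def pow mult_ac)
    qed (use T L Lipschitz \<rho>0 \<rho>34 \<rho>sq K in \<open>auto simp: q\<^sub>0_def m_def\<close>)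
    have c: "c \<ge> 4" using dyadic.c_ge by (simp add: c_def)
    define B where "B = 2 * c * L * q\<^sub>0"
    have "B \<ge> 0" using c L dyadic.q\<^sub>0 by (simp add: B_def)
    then obtain n where n: "B * \<rho> ^ n \<le> 1" "2 ^ n \<le> 1 + 2 * B powr (1 / \<beta>)"
      using dyadic_scale_exists[of B \<beta>] \<beta> unfolding \<rho>_def by auto
    have "B powr (1 / \<beta>) = (2 * c * L * (m * T powr \<beta>)) powr (1 / \<beta>) * K powr (1 / \<beta>)"
      using c L K by (simp add: B_def q\<^sub>0_def m_def mult_ac flip: powr_mult)
    then have n2: "2 ^ n \<le> 1 + C * K powr (1 / \<beta>)" using n(2) by (simp add: C_def)
    have q: "2 * dyadic_equation.c \<rho> * (L * dyadic.q n) \<le> 1"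
      using n(1) by (simp add: B_def c_def dyadic.q_def mult_ac)
    note x0 = RS_solution_initial[OF sol T]
    have "(2::real) ^ 2 ^ n = 2 powr (2 ^ n)" using powr_realpow[of 2 "2 ^ n"] by simp
    also have "\<dots> \<le> 2 powr (1 + C * K powr (1 / \<beta>))" using n2 by (intro powr_mono) auto
    finally have "2 ^ 2 ^ n * (norm x0 + norm (\<sigma> 0)) \<le> 2 powr (1 + C * K powr (1 / \<beta>)) * (norm x0 + norm (\<sigma> 0))"
      by (intro mult_right_mono) auto
    then have 1: "norm (x u) \<le> 2 powr (1 + C * K powr (1 / \<beta>)) * (norm x0 + norm (\<sigma> 0))"
      using dyadic.linear_growth_bound[OF q u] by (simp add: x0)
    have 2: "norm (x u) \<le> norm x0 + S * (1 + C * K powr (1 / \<beta>))" if S: "\<And>y. norm (\<sigma> y) \<le> S" for S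
    proof -
      have "S \<ge> 0" using S[of 0] by (rule order_trans[OF norm_ge_zero])
      then have "S * 2 ^ n \<le> S * (1 + C * K powr (1 / \<beta>))" using n2 by (rule mult_left_mono[rotated])
      then show ?thesis using dyadic.bounded_coefficient_bound[OF S q u] by (simp add: x0)
    qed
    from 1 2 show "norm (x u) \<le> 2 powr (1 + C * K powr (1 / \<beta>)) * (norm x0 + norm (\<sigma> 0)) \<and>
         (\<forall>S. (\<forall>y. norm (\<sigma> y) \<le> S) \<longrightarrow> norm (x u) \<le> norm x0 + S * (1 + C * K powr (1 / \<beta>)))" by blast
  qed
qed

text \<open>Up to the crossing point \<open>y\<^sub>0\<close> of C y^r and (a/2) y^2 the former is
  bounded by a constant, beyond it by the latter; (1 + K)^2 \<le> 2 + 2 K^2 then restores the full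
  coefficient a.\<close>

lemma exp_subquadratic_bound:
  fixes a r C :: real
  assumes a: "a > 0" and r: "0 \<le> r" "r < 2" and C: "C \<ge> 0"
  obtains c where "c \<ge> 0" "\<And>K. K \<ge> 0 \<Longrightarrow> exp (C * (1 + K) powr r) \<le> c * exp (a * K\<^sup>2)"
proof -
  define y\<^sub>0 where "y\<^sub>0 = (2 * C / a) powr (1 / (2 - r))"
  define c' where "c' = C * y\<^sub>0 powr r"
  have c': "c' \<ge> 0" using C by (simp add: c'_def)
  have main: "C * (1 + K) powr r \<le> (c' + a) + a * K\<^sup>2" if K: "K \<ge> 0" for K
  proof -
    define y where "y = 1 + K"
    have y: "y \<ge> 1" using K by (simp add: y_def)
    have "C * y powr r \<le> a / 2 * y\<^sup>2 + c'"
    proof (cases "y \<le> y\<^sub>0")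
      case True
      then have "C * y powr r \<le> c'" using C y r unfolding c'_def by (intro mult_left_mono powr_mono2) auto
      moreover have "0 \<le> a / 2 * y\<^sup>2" using a by simp
      ultimately show ?thesis by linarith
    next
      case False
      then have "y\<^sub>0 powr (2 - r) \<le> y powr (2 - r)" using r by (intro powr_mono2) (auto simp: y\<^sub>0_def)
      moreover have "y\<^sub>0 powr (2 - r) = 2 * C / a" using r C a by (simp add: y\<^sub>0_def powr_powr)
      ultimately have "C \<le> a / 2 * y powr (2 - r)" using a by (simp add: field_simps)
      then have "C * y powr r \<le> a / 2 * y powr (2 - r) * y powr r" by (intro mult_right_mono) auto
      also have "\<dots> = a / 2 * y\<^sup>2" using y by (simp flip: powr_add)
      finally show ?thesis using c' by linarith
    qed
    also have "y\<^sup>2 \<le> 2 + 2 * K\<^sup>2"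
      using sum_squares_bound[of 1 K] by (simp add: y_def power2_eq_square algebra_simps)
    finally show ?thesis using a by (simp add: y_def algebra_simps)
  qed
  show ?thesis
  proof (rule that[of "exp (c' + a)"])
    fix K :: real assume "K \<ge> 0"
    then show "exp (C * (1 + K) powr r) \<le> exp (c' + a) * exp (a * K\<^sup>2)"
      using main[of K] unfolding exp_add[symmetric] by simp
  qed simp
qed

lemma one_plus_powr_le:
  fixes C K r :: real
  assumes "C \<ge> 0" "K \<ge> 0" "r \<ge> 0"
  shows "1 + C * K powr r \<le> (1 + C) * (1 + K) powr r"
proof -
  have "1 \<le> (1 + K) powr r" using assms by (intro ge_one_powr_ge_zero) auto
  moreover have "C * K powr r \<le> C * (1 + K) powr r" using assms by (intro mult_left_mono powr_mono2) auto
  ultimately show ?thesis by (simp add: algebra_simps)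
qed

section \<open>Measurability of the supremum up to null sets\<close>

lemma borel_measurable_completion_AE:
  fixes f g :: "'a \<Rightarrow> real"
  assumes f: "f \<in> borel_measurable M" and eq: "AE x in M. f x = g x"
  shows "g \<in> borel_measurable (completion M)"
proof (rule measurableI)
  fix A :: "real set" assume A: "A \<in> sets borel"
  show "g -` A \<inter> space (completion M) \<in> sets (completion M)"
  proof (rule completion.in_sets_AE)
    show "f -` A \<inter> space M \<in> sets (completion M)" using measurable_sets[OF f A] by auto
    show "AE x in completion M. (x \<in> f -` A \<inter> space M) = (x \<in> g -` A \<inter> space (completion M))"
      using AE_completion[OF eq] by eventually_elim auto
  qed simp
qed simp

text \<open>For continuous paths the supremum over [0,T] equals that over a countable dense set and
  is therefore measurable. Almost sure continuity gives this only outside a null set, hence the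
  passage to the completion.\<close>

lemma finite_expectation_SUP:
  fixes Z :: "real \<Rightarrow> 'w \<Rightarrow> real"
  assumes meas: "\<And>t. t \<in> {0..T} \<Longrightarrow> Z t \<in> borel_measurable M" and T: "T > 0"
    and cont: "AE \<omega> in M. continuous_on {0..T} (\<lambda>t. Z t \<omega>)"
    and [measurable]: "\<phi> \<in> borel_measurable borel"
    and G: "integrable M G" and bound: "AE \<omega> in M. \<bar>\<phi> (SUP t\<in>{0..T}. Z t \<omega>)\<bar> \<le> G \<omega>"
  shows "finite_expectation M (\<lambda>\<omega>. \<phi> (SUP t\<in>{0..T}. Z t \<omega>))"
proof -
  obtain N where N: "N \<in> null_sets M" "{\<omega> \<in> space M. \<not> continuous_on {0..T} (\<lambda>t. Z t \<omega>)} \<subseteq> N"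
    using cont by (auto simp: eventually_ae_filter)
  have [measurable]: "N \<in> sets M" using N by auto
  \<comment> \<open>Setting the exceptional paths to 0 makes every path continuous, so the suprema
    over D are bounded at every sample point, as \<open>borel_measurable_cSUP\<close>
    demands.\<close>
  define Z' where "Z' = (\<lambda>t \<omega>. if \<omega> \<in> N then 0 else Z t \<omega>)"
  have meas': "Z' t \<in> borel_measurable M" if "t \<in> {0..T}" for t
    using meas[OF that] unfolding Z'_def by measurable
  have cont': "continuous_on {0..T} (\<lambda>t. Z' t \<omega>)" if "\<omega> \<in> space M" for \<omega>
    using N(2) that by (cases "\<omega> \<in> N") (auto simp: Z'_def)
  obtain D where D: "countable D" "D \<subseteq> {0..T}" "{0..T} \<subseteq> closure D" by (rule separable)
  have clD: "closure D = {0..T}" using D closure_minimal[of D "{0..T}"] by auto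
  have D0: "D \<noteq> {}" using clD T by auto
  have bdd: "bdd_above ((\<lambda>t. Z' t \<omega>) ` {0..T})" if "\<omega> \<in> space M" for \<omega>
    using compact_continuous_image[OF cont'[OF that]] by (intro bounded_imp_bdd_above compact_imp_bounded) auto
  have bddD: "bdd_above ((\<lambda>t. Z' t \<omega>) ` D)" if "\<omega> \<in> space M" for \<omega>
    using D(2) by (intro bdd_above_mono[OF bdd[OF that]] image_mono)
  have SUP_eq: "(SUP t\<in>D. Z' t \<omega>) = (SUP t\<in>{0..T}. Z' t \<omega>)" if \<omega>: "\<omega> \<in> space M" for \<omega>
  proof (rule antisym)
    show "(SUP t\<in>D. Z' t \<omega>) \<le> (SUP t\<in>{0..T}. Z' t \<omega>)"
      using D(2) D0 bdd[OF \<omega>] by (intro cSUP_subset_mono) auto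
    show "(SUP t\<in>{0..T}. Z' t \<omega>) \<le> (SUP t\<in>D. Z' t \<omega>)"
    proof (rule cSUP_least)
      fix t assume t: "t \<in> {0..T}"
      show "Z' t \<omega> \<le> (SUP t\<in>D. Z' t \<omega>)"
      proof (rule continuous_le_on_closure[of D "\<lambda>t. Z' t \<omega>"])
        show "continuous_on (closure D) (\<lambda>t. Z' t \<omega>)" "t \<in> closure D"
          unfolding clD by (fact cont'[OF \<omega>], fact t)
      qed (rule cSUP_upper[OF _ bddD[OF \<omega>]])
    qed (use T in auto)
  qed
  have "(\<lambda>\<omega>. SUP t\<in>D. Z' t \<omega>) \<in> borel_measurable M"
    using D(1,2) bddD meas' by (intro borel_measurable_cSUP) auto
  then have meas_SUP: "(\<lambda>\<omega>. \<phi> (SUP t\<in>D. Z' t \<omega>)) \<in> borel_measurable M" by measurable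
  have "AE \<omega> in M. \<phi> (SUP t\<in>D. Z' t \<omega>) = \<phi> (SUP t\<in>{0..T}. Z t \<omega>)"
    using AE_not_in[OF N(1)] AE_space
  proof eventually_elim
    case (elim \<omega>)
    then show ?case using SUP_eq[of \<omega>] by (simp add: Z'_def)
  qed
  from borel_measurable_completion_AE[OF meas_SUP this]
  have "(\<lambda>\<omega>. \<phi> (SUP t\<in>{0..T}. Z t \<omega>)) \<in> borel_measurable (completion M)" .
  moreover have "integrable (completion M) G"
    using G borel_measurable_integrable[OF G] by (simp add: integrable_completion)
  moreover have "AE \<omega> in completion M. norm (\<phi> (SUP t\<in>{0..T}. Z t \<omega>)) \<le> norm (G \<omega>)"
    using AE_completion[OF bound] by eventually_elim auto
  ultimately show ?thesis
    unfolding finite_expectation_def using Bochner_Integration.integrable_bound by blast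
qed

theorem theorem4p1:
  fixes M :: "'w measure"
    and B :: "real \<Rightarrow> 'w \<Rightarrow> real ^ 'm"
    and X :: "real \<Rightarrow> 'w \<Rightarrow> real ^ 'd"
    and \<sigma> :: "real ^ 'd \<Rightarrow> real ^ 'm ^ 'd"
    and \<sigma>' :: "real ^ 'd \<Rightarrow> (real ^ 'd) \<Rightarrow>\<^sub>L (real ^ 'm ^ 'd)"
    and x0 :: "real ^ 'd"
    and H T \<alpha> :: real
  assumes "prob_space M"
    and "fractional_brownian_motion M H B"
    and "AE \<omega> in M. continuous_on {0..} (\<lambda>t. B t \<omega>)"
    and "H > 1 / 2"
    and "T > 0"
    and "\<And>x. (\<sigma> has_derivative blinfun_apply (\<sigma>' x)) (at x)"
    and "continuous_on UNIV \<sigma>'"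
    and "bounded (range \<sigma>')"
    and "\<alpha> > 1 / H - 1"
    and "holder_continuous \<alpha> \<sigma>'"
    and "pathwise_sde_solution M T \<sigma> x0 B X"
  shows "(\<forall>p\<ge>2. finite_expectation M (\<lambda>\<omega>. SUP t\<in>{0..T}. norm (X t \<omega>) powr p)) \<and>
    (bounded (range \<sigma>) \<longrightarrow>
      (\<forall>\<beta> \<kappa> \<gamma>. 1 / 2 < \<beta> \<and> \<beta> < H \<and> \<kappa> > 0 \<and> 0 < \<gamma> \<and> \<gamma> < 2 * \<beta> \<longrightarrow>
        finite_expectation M (\<lambda>\<omega>. exp (\<kappa> * (SUP t\<in>{0..T}. norm (X t \<omega>) powr \<gamma>)))))"
proof -
  interpret prob_space M by fact
  have H: "1 / 2 < H" and T: "T > 0" by fact+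
  obtain L0 where L0: "\<And>x. norm (\<sigma>' x) \<le> L0"
    using \<open>bounded (range \<sigma>')\<close> by (auto simp: bounded_iff)
  define L where "L = max 1 L0"
  have L: "L \<ge> 1" by (simp add: L_def)
  have Lipschitz: "norm (\<sigma> x - \<sigma> y) \<le> L * norm (x - y)" for x y
    by (rule differentiable_bound[of UNIV \<sigma> "\<lambda>x. blinfun_apply (\<sigma>' x)"])
      (use assms(6) L0 in \<open>auto simp: L_def le_max_iff_disj simp flip: norm_blinfun.rep_eq\<close>)
  have X_meas: "X t \<in> borel_measurable M" if "t \<in> {0..T}" for t
    using assms(11) that by (simp add: pathwise_sde_solution_def)
  have sol: "AE \<omega> in M. RS_solution T \<sigma> x0 (\<lambda>t. B t \<omega>) (\<lambda>t. X t \<omega>)"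
    using assms(11) unfolding pathwise_sde_solution_def RS_solution_def by simp
  \<comment> \<open>Both bounds are expressed by powers of 1 + K with exp(a K^2) below an integrable
    G, the form that \<open>exp_subquadratic_bound\<close> can dominate.\<close>
  have key: "\<exists>C\<ge>0. \<exists>a>0. \<exists>G. integrable M G \<and> (AE \<omega> in M. \<exists>K\<ge>0. exp (a * K\<^sup>2) \<le> G \<omega> \<and>
      (\<forall>u\<in>{0..T}. norm (X u \<omega>) \<le> exp (C * (1 + K) powr (1 / \<beta>)) * (norm x0 + norm (\<sigma> 0)) \<and>
         (\<forall>S. (\<forall>y. norm (\<sigma> y) \<le> S) \<longrightarrow> norm (X u \<omega>) \<le> (norm x0 + S * C) * (1 + K) powr (1 / \<beta>))))"
    if \<beta>: "1/2 < \<beta>" "\<beta> < H" for \<beta>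
  proof -
    obtain C where C: "C \<ge> 0" "\<And>K x0 b x u. \<lbrakk>K \<ge> 0; RS_solution T \<sigma> x0 b x; u \<in> {0..T};
       \<And>n k j. k < 2 ^ n \<Longrightarrow> \<bar>b (dyad T n (Suc k)) $ j - b (dyad T n k) $ j\<bar> \<le> K * (T / 2 ^ n) powr \<beta>\<rbrakk>
       \<Longrightarrow> norm (x u) \<le> 2 powr (1 + C * K powr (1 / \<beta>)) * (norm x0 + norm (\<sigma> 0)) \<and>
         (\<forall>S. (\<forall>y. norm (\<sigma> y) \<le> S) \<longrightarrow> norm (x u) \<le> norm x0 + S * (1 + C * K powr (1 / \<beta>)))"
      by (rule RS_solution_bounds[OF T L \<beta>(1) Lipschitz]) blast
    obtain a G where a: "a > 0" and G: "integrable M G" "\<And>\<omega>. G \<omega> \<ge> 1"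
      "AE \<omega> in M. \<forall>n k j. k < 2 ^ n \<longrightarrow>
         exp (a * ((B (dyad T n (Suc k)) \<omega> $ j - B (dyad T n k) \<omega> $ j) / (T / 2 ^ n) powr \<beta>)\<^sup>2) \<le> G \<omega>"
      using fbm_dyadic_modulus[OF assms(2) T \<beta>(2)] by blast
    have "AE \<omega> in M. \<exists>K\<ge>0. exp (a * K\<^sup>2) \<le> G \<omega> \<and>
      (\<forall>u\<in>{0..T}. norm (X u \<omega>) \<le> exp ((1 + C) * (1 + K) powr (1 / \<beta>)) * (norm x0 + norm (\<sigma> 0)) \<and>
         (\<forall>S. (\<forall>y. norm (\<sigma> y) \<le> S) \<longrightarrow> norm (X u \<omega>) \<le> (norm x0 + S * (1 + C)) * (1 + K) powr (1 / \<beta>)))"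
      using G(3) sol
    proof eventually_elim
      case (elim \<omega>)
      \<comment> \<open>K solves exp(a K^2) = G; it is real because G \<ge> 1. The bound on all
        exponentials of squared increments thus becomes a \<beta>-modulus with constant K.\<close>
      define K where "K = sqrt (ln (G \<omega>) / a)"
      have K0: "K \<ge> 0" using G(2)[of \<omega>] a by (simp add: K_def)
      have aK: "a * K\<^sup>2 = ln (G \<omega>)" using G(2)[of \<omega>] a by (simp add: K_def)
      then have expK: "exp (a * K\<^sup>2) = G \<omega>" using G(2)[of \<omega>] by simp
      have incr: "\<bar>B (dyad T n (Suc k)) \<omega> $ j - B (dyad T n k) \<omega> $ j\<bar> \<le> K * (T / 2 ^ n) powr \<beta>"
        if "k < 2 ^ n" for n k j
      proof -
        define z where "z = B (dyad T n (Suc k)) \<omega> $ j - B (dyad T n k) \<omega> $ j"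
        have h: "(T / 2 ^ n) powr \<beta> > 0" using T by simp
        have "exp (a * (z / (T / 2 ^ n) powr \<beta>)\<^sup>2) \<le> exp (a * K\<^sup>2)"
          using elim(1) that unfolding expK z_def by blast
        then have "\<bar>z / (T / 2 ^ n) powr \<beta>\<bar> \<le> K"
          using a K0 abs_le_square_iff[of "z / (T / 2 ^ n) powr \<beta>" K] by simp
        then show ?thesis using h by (simp add: abs_divide pos_divide_le_eq z_def)
      qed
      define R where "R = (1 + K) powr (1 / \<beta>)"
      have R: "1 + C * K powr (1 / \<beta>) \<le> (1 + C) * R" "1 \<le> R"
        using one_plus_powr_le[OF C(1) K0, of "1 / \<beta>"] K0 \<beta> ge_one_powr_ge_zero[of "1 + K" "1 / \<beta>"] by (auto simp: R_def)
      have "norm (X u \<omega>) \<le> exp ((1 + C) * R) * (norm x0 + norm (\<sigma> 0)) \<and>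
         (\<forall>S. (\<forall>y. norm (\<sigma> y) \<le> S) \<longrightarrow> norm (X u \<omega>) \<le> (norm x0 + S * (1 + C)) * R)"
        if u: "u \<in> {0..T}" for u
      proof (intro conjI allI impI)
        have nX: "norm (X u \<omega>) \<le> 2 powr (1 + C * K powr (1 / \<beta>)) * (norm x0 + norm (\<sigma> 0))"
          "\<And>S. (\<forall>y. norm (\<sigma> y) \<le> S) \<Longrightarrow> norm (X u \<omega>) \<le> norm x0 + S * (1 + C * K powr (1 / \<beta>))"
          using C(2)[OF K0 elim(2) u incr] by auto
        have "(2::real) powr (1 + C * K powr (1 / \<beta>)) \<le> 2 powr ((1 + C) * R)" using R by (intro powr_mono) auto
        also have "\<dots> \<le> exp 1 powr ((1 + C) * R)"
          using exp_ge_add_one_self[of 1] C(1) R(2) by (intro powr_mono2) auto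
        also have "\<dots> = exp ((1 + C) * R)" by (simp add: powr_def)
        finally have "2 powr (1 + C * K powr (1 / \<beta>)) * (norm x0 + norm (\<sigma> 0)) \<le>
            exp ((1 + C) * R) * (norm x0 + norm (\<sigma> 0))" by (intro mult_right_mono) auto
        with nX(1) show "norm (X u \<omega>) \<le> exp ((1 + C) * R) * (norm x0 + norm (\<sigma> 0))" by (rule order_trans)
        fix S assume S: "\<forall>y. norm (\<sigma> y) \<le> S"
        have S0: "S \<ge> 0" using S norm_ge_zero order_trans by blast
        have "S * (1 + C * K powr (1 / \<beta>)) \<le> S * ((1 + C) * R)" using R(1) S0 by (rule mult_left_mono)
        moreover have "norm x0 * 1 \<le> norm x0 * R" using R(2) by (intro mult_left_mono) auto
        ultimately show "norm (X u \<omega>) \<le> (norm x0 + S * (1 + C)) * R"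
          using nX(2)[OF S] by (simp add: algebra_simps)
      qed
      then show ?case using K0 expK unfolding R_def by (intro exI[of _ K]) auto
    qed
    then show ?thesis using C(1) a G(1)
      by (intro exI[of _ "1 + C"] conjI exI[of _ a] exI[of _ G]) auto
  qed
  have cont: "AE \<omega> in M. continuous_on {0..T} (\<lambda>t. norm (X t \<omega>) powr p)" if "p > 0" for p
    using sol
  proof (rule eventually_mono)
    fix \<omega> assume "RS_solution T \<sigma> x0 (\<lambda>t. B t \<omega>) (\<lambda>t. X t \<omega>)"
    then have "continuous_on {0..T} (\<lambda>t. X t \<omega>)" by (simp add: RS_solution_def)
    then show "continuous_on {0..T} (\<lambda>t. norm (X t \<omega>) powr p)"
      using that by (intro continuous_on_powr' continuous_on_norm continuous_on_const) auto
  qed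
  have meas: "(\<lambda>\<omega>. norm (X t \<omega>) powr p) \<in> borel_measurable M" if "t \<in> {0..T}" for t p
    using X_meas[OF that] by measurable
  \<comment> \<open>An upper bound is required because a real supremum is informative only for sets
    bounded above.\<close>
  have SUP_nonneg: "0 \<le> (SUP t\<in>{0..T}. norm (X t \<omega>) powr p)"
    if "\<And>u. u \<in> {0..T} \<Longrightarrow> norm (X u \<omega>) powr p \<le> b" for p b \<omega>
    by (rule cSUP_upper2[where x = 0]) (use that T in \<open>auto intro: bdd_aboveI2[where M = b]\<close>)
  have SUP_le: "(SUP t\<in>{0..T}. norm (X t \<omega>) powr p) \<le> b"
    if "\<And>u. u \<in> {0..T} \<Longrightarrow> norm (X u \<omega>) powr p \<le> b" for p b \<omega>
    using that T by (intro cSUP_least) auto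
  show ?thesis
  proof (intro conjI allI impI)
    fix p :: real assume p: "p \<ge> 2"
    \<comment> \<open>The moment claim names no \<beta>; the midpoint of 1/2 and H is one admissible
      choice.\<close>
    define \<beta> where "\<beta> = (1 / 2 + H) / 2"
    have \<beta>: "1 / 2 < \<beta>" "\<beta> < H" using H by (auto simp: \<beta>_def)
    then have r: "0 \<le> 1 / \<beta>" "1 / \<beta> < 2" by (auto simp: field_simps)
    define A where "A = norm x0 + norm (\<sigma> 0)"
    obtain C a G where C: "C \<ge> 0" "a > 0" and G: "integrable M G" and
      bd: "AE \<omega> in M. \<exists>K\<ge>0. exp (a * K\<^sup>2) \<le> G \<omega> \<and>
        (\<forall>u\<in>{0..T}. norm (X u \<omega>) \<le> exp (C * (1 + K) powr (1 / \<beta>)) * (norm x0 + norm (\<sigma> 0)) \<and>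
         (\<forall>S. (\<forall>y. norm (\<sigma> y) \<le> S) \<longrightarrow> norm (X u \<omega>) \<le> (norm x0 + S * C) * (1 + K) powr (1 / \<beta>)))"
      using key[OF \<beta>] by blast
    obtain c where c: "c \<ge> 0" "\<And>K. K \<ge> 0 \<Longrightarrow> exp (p * C * (1 + K) powr (1 / \<beta>)) \<le> c * exp (a * K\<^sup>2)"
      using exp_subquadratic_bound[OF C(2) r, of "p * C"] C(1) p by auto
    have "AE \<omega> in M. \<bar>SUP t\<in>{0..T}. norm (X t \<omega>) powr p\<bar> \<le> A powr p * c * G \<omega>"
      using bd
    proof eventually_elim
      case (elim \<omega>)
      then obtain K where K: "K \<ge> 0" "exp (a * K\<^sup>2) \<le> G \<omega>"
        "\<And>u. u \<in> {0..T} \<Longrightarrow> norm (X u \<omega>) \<le> exp (C * (1 + K) powr (1 / \<beta>)) * A" unfolding A_def by blast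
      have "norm (X u \<omega>) powr p \<le> A powr p * c * G \<omega>" if u: "u \<in> {0..T}" for u
      proof -
        have "norm (X u \<omega>) powr p \<le> (exp (C * (1 + K) powr (1 / \<beta>)) * A) powr p"
          using K(3)[OF u] p by (intro powr_mono2) auto
        also have "\<dots> = exp (p * C * (1 + K) powr (1 / \<beta>)) * A powr p"
          by (subst powr_mult) (simp add: powr_def[of "exp _"] mult_ac)
        also have "\<dots> \<le> c * G \<omega> * A powr p"
          using c(2)[OF K(1)] mult_left_mono[OF K(2) c(1)] by (intro mult_right_mono) auto
        finally show ?thesis by (simp add: mult_ac)
      qed
      then show ?case using SUP_nonneg[of \<omega> p] SUP_le[of \<omega> p] by fastforce
    qed
    then show "finite_expectation M (\<lambda>\<omega>. SUP t\<in>{0..T}. norm (X t \<omega>) powr p)"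
      using G p by (intro finite_expectation_SUP[where \<phi> = "\<lambda>x. x" and G = "\<lambda>\<omega>. A powr p * c * G \<omega>"] meas cont T) auto
  next
    fix \<beta> \<kappa> \<gamma> :: real
    assume "bounded (range \<sigma>)" and "1 / 2 < \<beta> \<and> \<beta> < H \<and> \<kappa> > 0 \<and> 0 < \<gamma> \<and> \<gamma> < 2 * \<beta>"
    then have \<beta>: "1 / 2 < \<beta>" "\<beta> < H" and \<kappa>: "\<kappa> > 0" and \<gamma>: "0 < \<gamma>" "\<gamma> < 2 * \<beta>" by auto
    obtain S where S: "\<And>y. norm (\<sigma> y) \<le> S" using \<open>bounded (range \<sigma>)\<close> by (auto simp: bounded_iff)
    have r: "0 \<le> \<gamma> / \<beta>" "\<gamma> / \<beta> < 2" using \<beta> \<gamma> by (auto simp: field_simps)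
    obtain C a G where C: "C \<ge> 0" "a > 0" and G: "integrable M G" and
      bd: "AE \<omega> in M. \<exists>K\<ge>0. exp (a * K\<^sup>2) \<le> G \<omega> \<and>
        (\<forall>u\<in>{0..T}. norm (X u \<omega>) \<le> exp (C * (1 + K) powr (1 / \<beta>)) * (norm x0 + norm (\<sigma> 0)) \<and>
         (\<forall>S. (\<forall>y. norm (\<sigma> y) \<le> S) \<longrightarrow> norm (X u \<omega>) \<le> (norm x0 + S * C) * (1 + K) powr (1 / \<beta>)))"
      using key[OF \<beta>] by blast
    define A where "A = norm x0 + S * C"
    have "A \<ge> 0" using C(1) order_trans[OF norm_ge_zero S[of 0]] by (simp add: A_def)
    \<comment> \<open>The \<gamma>-th power turns the exponent 1/\<beta> of 1 + K into
      \<gamma>/\<beta>, which is below 2 precisely because \<gamma> < 2 \<beta>; this is why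
      \<kappa> may be arbitrarily large.\<close>
    obtain c where c: "c \<ge> 0" "\<And>K. K \<ge> 0 \<Longrightarrow> exp (\<kappa> * A powr \<gamma> * (1 + K) powr (\<gamma> / \<beta>)) \<le> c * exp (a * K\<^sup>2)"
      using exp_subquadratic_bound[OF C(2) r, of "\<kappa> * A powr \<gamma>"] \<kappa> by auto
    have "AE \<omega> in M. \<bar>exp (\<kappa> * (SUP t\<in>{0..T}. norm (X t \<omega>) powr \<gamma>))\<bar> \<le> c * G \<omega>"
      using bd
    proof eventually_elim
      case (elim \<omega>)
      then obtain K where K: "K \<ge> 0" "exp (a * K\<^sup>2) \<le> G \<omega>"
        "\<And>u. u \<in> {0..T} \<Longrightarrow> norm (X u \<omega>) \<le> A * (1 + K) powr (1 / \<beta>)"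
        unfolding A_def using S by blast
      have "norm (X u \<omega>) powr \<gamma> \<le> A powr \<gamma> * (1 + K) powr (\<gamma> / \<beta>)" if u: "u \<in> {0..T}" for u
      proof -
        have "norm (X u \<omega>) powr \<gamma> \<le> (A * (1 + K) powr (1 / \<beta>)) powr \<gamma>"
          using K(3)[OF u] \<gamma> by (intro powr_mono2) auto
        also have "\<dots> = A powr \<gamma> * (1 + K) powr (\<gamma> / \<beta>)"
          using \<open>A \<ge> 0\<close> K(1) by (simp add: powr_mult powr_powr)
        finally show ?thesis .
      qed
      then have "\<kappa> * (SUP t\<in>{0..T}. norm (X t \<omega>) powr \<gamma>) \<le> \<kappa> * (A powr \<gamma> * (1 + K) powr (\<gamma> / \<beta>))"
        using \<kappa> by (intro mult_left_mono SUP_le) auto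
      then have "exp (\<kappa> * (SUP t\<in>{0..T}. norm (X t \<omega>) powr \<gamma>)) \<le> exp (\<kappa> * A powr \<gamma> * (1 + K) powr (\<gamma> / \<beta>))"
        by (simp add: mult_ac)
      also have "\<dots> \<le> c * exp (a * K\<^sup>2)" by (rule c(2)[OF K(1)])
      also have "\<dots> \<le> c * G \<omega>" using K(2) c(1) by (rule mult_left_mono)
      finally show ?case by simp
    qed
    then show "finite_expectation M (\<lambda>\<omega>. exp (\<kappa> * (SUP t\<in>{0..T}. norm (X t \<omega>) powr \<gamma>)))"
      using G \<gamma> by (intro finite_expectation_SUP[where \<phi> = "\<lambda>x. exp (\<kappa> * x)" and G = "\<lambda>\<omega>. c * G \<omega>"] meas cont T) auto
  qed
qed

end
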